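(* Let $T>0$, $u_0\in\mathbb{R}$, and let $\alpha,\beta,f\in C^\infty(\mathbb{R})$ be real analytic functions such that the Itô stochastic differential equation $du=\alpha(u)\,dt+\beta(u)\,dW$, $u(0)=u_0$, admits a unique solution $u$ on $[0,T]$. Then the associated Feller semigroup admits the formal power series representation (in $t$) $$\mathbb{E}^{u_0}[f(u_t)]=\sum_{\tau\in\mathcal{T}^{\mathfrak e}_{\alpha,\beta}}\frac{|\tau|}{\sigma_{\mathfrak e}(\tau)\,\tau!}\,\Upsilon^{\alpha,\beta,f}_{u_0}(\tau)\,t^{|\tau|-1},$$ where the sum runs over all exotic coloured trees.
   Context: Formal representation: $W$ is a one-dimensional Wiener process and $L:=\alpha\,\partial_x+\tfrac12\beta^2\,\partial_x^2$ is the generator. As a formal power series in $t$, $\mathbb{E}^{u_0}[f(u_t)]$ is understood as its Itô–Taylor series $\sum_{k\ge0}\frac{t^k}{k!}(L^kf)(u_0)$, obtained by iterating Itô's formula and taking expectations; the claimed equality is an equality of formal power series (coefficient by coefficient), with no convergence asserted. Exotic coloured trees: an exotic coloured tree $\tau$ is a finite non-planar rooted tree with edges oriented towards the root $\rho_\tau$; the root is uncoloured; every non-root vertex $v$ has a colour $\mathfrak t(v)\in\{\alpha,\beta\}$; the set $\mathcal V_\beta(\tau)$ of $\beta$-coloured vertices has even cardinality and is equipped with an exotic decoration $\mathfrak e$, i.e. a partition of $\mathcal V_\beta(\tau)$ into pairs ($\mathfrak e(v)=\mathfrak e(w)$ iff $v,w$ are in the same pair; the labels naming the pairs are irrelevant).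 Paired vertices may be anywhere in the tree. $\mathcal V_\alpha(\tau)$ is the set of $\alpha$-coloured vertices. $\mathcal{T}^{\mathfrak e}_{\alpha,\beta}$ is the set of isomorphism classes of such trees (including the single root $\bullet$). Set $|\tau|:=|\mathcal V_\alpha(\tau)|+\tfrac12|\mathcal V_\beta(\tau)|+1$, and let $\mathfrak n(v)$ be the number of incoming edges (children) of $v$. Symmetry factor: $\sigma_{\mathfrak e}(\tau)$ is the number of automorphisms of the rooted tree $\tau$ preserving the colours and the partition of $\mathcal V_\beta(\tau)$ into pairs (pairs may be permuted among themselves). Tree factorial: $1/\tau!$ is defined recursively by $1/\bullet!=1$ and, for $|\tau|>1$, $$\frac{|\tau|}{\tau!}=\sum_{\tau'}\frac{m_\alpha(\tau',\tau)}{\tau'!}+\sum_{\tau'}\frac{m_\beta(\tau',\tau)}{\tau'!},$$ where $m_\alpha(\tau',\tau)$ is the number of $\alpha$-coloured leaves of $\tau$ whose removal yields $\tau'$, $m_\beta(\tau',\tau)$ is the number of pairs of $\beta$-vertices with the same exotic decoration, both leaves of $\tau$, whose simultaneous removal yields $\tau'$, and sums run over isomorphism classes. Empty sums are zero (in which case $1/\tau!=0$). Elementary differential: for $x\in\mathbb{R}$, $\Upsilon^{\alpha,\beta,f}_{x}(\tau):=f^{(\mathfrak n(\rho_\tau))}(x)\prod_{v\ne\rho_\tau}\mathfrak t(v)^{(\mathfrak n(v))}(x)$, where $\mathfrak t(v)\in\{\alpha,\beta\}$ is regarded as the corresponding coefficient function. *)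

theory Defs
  imports "HOL-Probability.Probability" "HOL-Combinatorics.Permutations"
begin

section \<open>Exotic coloured trees\<close>

datatype colour = Alpha | Beta

text \<open>
  A rooted tree with edges oriented towards the root is given by its vertex set, its root and the
  function sending each non-root vertex to the target of its unique outgoing edge.
  The values of \<open>parent\<close> and \<open>vcolour\<close> at the root and outside \<open>verts\<close> carry no meaning.
  The exotic decoration is the set \<open>pairing\<close> of its pairs. Every finite tree is isomorphic to
  one whose vertices are natural numbers.
\<close>

record pre_tree =
  verts :: "nat set"
  troot :: nat
  parent :: "nat \<Rightarrow> nat"
  vcolour :: "nat \<Rightarrow> colour"
  pairing :: "nat set set"

definition inner_verts :: "pre_tree \<Rightarrow> nat set" where
  "inner_verts \<tau> = verts \<tau> - {troot \<tau>}"

definition coloured_verts :: "colour \<Rightarrow> pre_tree \<Rightarrow> nat set" where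
  "coloured_verts c \<tau> = {v \<in> inner_verts \<tau>. vcolour \<tau> v = c}"

definition exotic_wf :: "pre_tree \<Rightarrow> bool" where
  "exotic_wf \<tau> \<longleftrightarrow>
     finite (verts \<tau>) \<and> troot \<tau> \<in> verts \<tau> \<and>
     (\<forall>v\<in>inner_verts \<tau>. parent \<tau> v \<in> verts \<tau>) \<and>
     (\<forall>v\<in>verts \<tau>. \<exists>k. (parent \<tau> ^^ k) v = troot \<tau>) \<and>
     partition_on (coloured_verts Beta \<tau>) (pairing \<tau>) \<and>
     (\<forall>p\<in>pairing \<tau>. card p = 2)"

definition exotic_iso :: "(nat \<Rightarrow> nat) \<Rightarrow> pre_tree \<Rightarrow> pre_tree \<Rightarrow> bool" where
  "exotic_iso \<phi> \<tau> \<tau>' \<longleftrightarrow>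
     bij_betw \<phi> (verts \<tau>) (verts \<tau>') \<and> \<phi> (troot \<tau>) = troot \<tau>' \<and>
     (\<forall>v\<in>inner_verts \<tau>. \<phi> (parent \<tau> v) = parent \<tau>' (\<phi> v) \<and>
                          vcolour \<tau>' (\<phi> v) = vcolour \<tau> v) \<and>
     (\<lambda>p. \<phi> ` p) ` pairing \<tau> = pairing \<tau>'"

definition exotic_equiv :: "pre_tree \<Rightarrow> pre_tree \<Rightarrow> bool" where
  "exotic_equiv \<tau> \<tau>' \<longleftrightarrow> exotic_wf \<tau> \<and> exotic_wf \<tau>' \<and> (\<exists>\<phi>. exotic_iso \<phi> \<tau> \<tau>')"

definition children :: "pre_tree \<Rightarrow> nat \<Rightarrow> nat set" where
  "children \<tau> v = {w \<in> inner_verts \<tau>. parent \<tau> w = v}"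

definition is_leaf :: "pre_tree \<Rightarrow> nat \<Rightarrow> bool" where
  "is_leaf \<tau> v \<longleftrightarrow> v \<in> inner_verts \<tau> \<and> children \<tau> v = {}"

definition remove_verts :: "pre_tree \<Rightarrow> nat set \<Rightarrow> pre_tree" where
  "remove_verts \<tau> X =
     \<tau>\<lparr>verts := verts \<tau> - X, pairing := {p \<in> pairing \<tau>. p \<inter> X = {}}\<rparr>"


subsection \<open>Invariance under isomorphism\<close>

lemma bij_betw_restrict_Collect:
  assumes "bij_betw \<phi> A B" "\<And>v. v \<in> A \<Longrightarrow> Q (\<phi> v) \<longleftrightarrow> P v"
  shows "bij_betw \<phi> {v \<in> A. P v} {w \<in> B. Q w}"
proof (rule bij_betw_imageI)
  show "inj_on \<phi> {v \<in> A. P v}"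
    using assms(1) by (auto simp: bij_betw_def inj_on_def)
  show "\<phi> ` {v \<in> A. P v} = {w \<in> B. Q w}"
    using assms(2) bij_betw_imp_surj_on[OF assms(1)] by blast
qed

lemma bij_betw_Diff_image:
  assumes "bij_betw \<phi> A B" "X \<subseteq> A"
  shows "bij_betw \<phi> (A - X) (B - \<phi> ` X)"
proof (rule bij_betw_imageI)
  show "inj_on \<phi> (A - X)" using assms(1) by (auto simp: bij_betw_def inj_on_def)
  show "\<phi> ` (A - X) = B - \<phi> ` X"
    using assms unfolding bij_betw_def by (metis Diff_subset inj_on_image_set_diff)
qed

lemma iso_inner:
  assumes "exotic_iso \<phi> \<tau> \<tau>'" "exotic_wf \<tau>"
  shows "bij_betw \<phi> (inner_verts \<tau>) (inner_verts \<tau>')"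
proof -
  have "bij_betw \<phi> (verts \<tau> - {troot \<tau>}) (verts \<tau>' - \<phi> ` {troot \<tau>})"
    using assms unfolding exotic_iso_def exotic_wf_def by (intro bij_betw_Diff_image) auto
  then show ?thesis
    using assms by (simp add: inner_verts_def exotic_iso_def)
qed

lemma exotic_iso_refl: "exotic_iso id \<tau> \<tau>"
  by (auto simp: exotic_iso_def)

lemma pairing_subset:
  assumes "exotic_wf \<tau>" "p \<in> pairing \<tau>"
  shows "p \<subseteq> coloured_verts Beta \<tau>" "p \<subseteq> inner_verts \<tau>" "p \<subseteq> verts \<tau>"
  using assms unfolding exotic_wf_def partition_on_def coloured_verts_def inner_verts_def by blast+

lemma exotic_iso_sym:
  assumes "exotic_iso \<phi> \<tau> \<tau>'" "exotic_wf \<tau>"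
  shows "exotic_iso (inv_into (verts \<tau>) \<phi>) \<tau>' \<tau>"
proof -
  let ?\<psi> = "inv_into (verts \<tau>) \<phi>"
  have b: "bij_betw \<phi> (verts \<tau>) (verts \<tau>')" using assms by (simp add: exotic_iso_def)
  have inv: "?\<psi> (\<phi> v) = v" if "v \<in> verts \<tau>" for v
    using b that by (simp add: bij_betw_def)
  have r: "troot \<tau> \<in> verts \<tau>" using assms by (simp add: exotic_wf_def)
  have *: "?\<psi> (parent \<tau>' w) = parent \<tau> (?\<psi> w) \<and> vcolour \<tau> (?\<psi> w) = vcolour \<tau>' w"
    if w: "w \<in> inner_verts \<tau>'" for w
  proof -
    obtain v where v: "v \<in> inner_verts \<tau>" "w = \<phi> v"
      using iso_inner[OF assms] w by (auto simp: bij_betw_def)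
    have "v \<in> verts \<tau>" "parent \<tau> v \<in> verts \<tau>"
      using v assms by (auto simp: inner_verts_def exotic_wf_def)
    then show ?thesis
      using v assms inv by (auto simp: exotic_iso_def) (metis inv)
  qed
  have "(\<lambda>p. ?\<psi> ` p) ` pairing \<tau>' = (\<lambda>p. ?\<psi> ` (\<phi> ` p)) ` pairing \<tau>"
  proof -
    have "pairing \<tau>' = (\<lambda>p. \<phi> ` p) ` pairing \<tau>" using assms(1) by (simp add: exotic_iso_def)
    then show ?thesis by (simp only: image_image)
  qed
  also have "\<dots> = (\<lambda>p. p) ` pairing \<tau>"
  proof (rule image_cong[OF refl])
    fix p assume "p \<in> pairing \<tau>"
    then have "p \<subseteq> verts \<tau>" by (rule pairing_subset(3)[OF assms(2)])
    then show "?\<psi> ` (\<phi> ` p) = p"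
      using inv by (force simp: image_image)
  qed
  finally show ?thesis
    using b * inv[OF r] assms(1) unfolding exotic_iso_def
    by (auto simp: bij_betw_inv_into)
qed

lemma exotic_iso_trans:
  assumes "exotic_iso \<phi> \<tau> \<tau>'" "exotic_iso \<psi> \<tau>' \<tau>''" "exotic_wf \<tau>"
  shows "exotic_iso (\<psi> \<circ> \<phi>) \<tau> \<tau>''"
proof -
  have "\<phi> v \<in> inner_verts \<tau>'" if "v \<in> inner_verts \<tau>" for v
    using iso_inner[OF assms(1,3)] that by (auto simp: bij_betw_def)
  moreover have "(\<lambda>p. (\<psi> \<circ> \<phi>) ` p) ` pairing \<tau> = pairing \<tau>''"
  proof -
    have "(\<lambda>p. (\<psi> \<circ> \<phi>) ` p) ` pairing \<tau> = (\<lambda>p. \<psi> ` p) ` ((\<lambda>p. \<phi> ` p) ` pairing \<tau>)"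
      by (simp add: image_image image_comp)
    then show ?thesis using assms by (simp add: exotic_iso_def)
  qed
  ultimately show ?thesis
    using assms unfolding exotic_iso_def by (auto intro: bij_betw_trans)
qed

lemma exotic_iso_cong:
  assumes "exotic_iso \<phi> \<tau> \<tau>'" "exotic_wf \<tau>" "\<And>v. v \<in> verts \<tau> \<Longrightarrow> \<psi> v = \<phi> v"
  shows "exotic_iso \<psi> \<tau> \<tau>'"
proof -
  have "bij_betw \<psi> (verts \<tau>) (verts \<tau>')"
    using assms bij_betw_cong[of "verts \<tau>" \<psi> \<phi>] by (simp add: exotic_iso_def)
  moreover have "(\<lambda>p. \<psi> ` p) ` pairing \<tau> = (\<lambda>p. \<phi> ` p) ` pairing \<tau>"
    using pairing_subset(3)[OF assms(2)] assms(3) by (intro image_cong) auto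
  moreover have "parent \<tau> v \<in> verts \<tau>" "v \<in> verts \<tau>" if "v \<in> inner_verts \<tau>" for v
    using that assms(2) by (auto simp: exotic_wf_def inner_verts_def)
  ultimately show ?thesis
    using assms by (auto simp: exotic_iso_def exotic_wf_def)
qed

lemma exotic_equiv_sym: "exotic_equiv \<tau> \<tau>' \<Longrightarrow> exotic_equiv \<tau>' \<tau>"
  unfolding exotic_equiv_def using exotic_iso_sym by blast

lemma exotic_equiv_trans: "exotic_equiv \<tau> \<tau>' \<Longrightarrow> exotic_equiv \<tau>' \<tau>'' \<Longrightarrow> exotic_equiv \<tau> \<tau>''"
  unfolding exotic_equiv_def using exotic_iso_trans by blast

lemma part_equivp_exotic_equiv: "part_equivp exotic_equiv"
proof (rule part_equivpI)
  let ?\<tau> = "\<lparr>verts = {0}, troot = 0, parent = \<lambda>_. 0, vcolour = \<lambda>_. Alpha, pairing = {}\<rparr>"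
  have "exotic_wf ?\<tau>"
    by (auto simp: exotic_wf_def inner_verts_def coloured_verts_def partition_on_def
             intro: exI[of _ 0])
  then show "\<exists>\<tau>. exotic_equiv \<tau> \<tau>"
    using exotic_iso_refl exotic_equiv_def by blast
  show "symp exotic_equiv" using exotic_equiv_sym by (auto intro: sympI)
  show "transp exotic_equiv" using exotic_equiv_trans by (auto intro: transpI)
qed

lemma exotic_equivE:
  assumes "exotic_equiv \<tau> \<tau>'"
  obtains \<phi> where "exotic_iso \<phi> \<tau> \<tau>'" "exotic_wf \<tau>" "exotic_wf \<tau>'"
  using assms by (auto simp: exotic_equiv_def)

lemma iso_coloured:
  assumes "exotic_iso \<phi> \<tau> \<tau>'" "exotic_wf \<tau>"
  shows "bij_betw \<phi> (coloured_verts c \<tau>) (coloured_verts c \<tau>')"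
  unfolding coloured_verts_def
  using iso_inner[OF assms] assms(1)
  by (intro bij_betw_restrict_Collect) (auto simp: exotic_iso_def)

lemma iso_children:
  assumes "exotic_iso \<phi> \<tau> \<tau>'" "exotic_wf \<tau>" "v \<in> verts \<tau>"
  shows "bij_betw \<phi> (children \<tau> v) (children \<tau>' (\<phi> v))"
proof -
  have b: "bij_betw \<phi> (inner_verts \<tau>) (inner_verts \<tau>')" by (rule iso_inner[OF assms(1,2)])
  have inj: "inj_on \<phi> (verts \<tau>)" using assms by (simp add: exotic_iso_def bij_betw_def)
  have par: "parent \<tau>' (\<phi> w) = \<phi> v \<longleftrightarrow> parent \<tau> w = v" if "w \<in> inner_verts \<tau>" for w
  proof -
    have "parent \<tau> w \<in> verts \<tau>" using that assms by (auto simp: exotic_wf_def)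
    moreover have "parent \<tau>' (\<phi> w) = \<phi> (parent \<tau> w)"
      using that assms by (auto simp: exotic_iso_def)
    ultimately show ?thesis using inj assms(3) by (auto dest: inj_onD)
  qed
  show ?thesis
    unfolding children_def using b par by (rule bij_betw_restrict_Collect)
qed

lemma iso_leaf:
  assumes "exotic_iso \<phi> \<tau> \<tau>'" "exotic_wf \<tau>" "v \<in> inner_verts \<tau>"
  shows "is_leaf \<tau>' (\<phi> v) \<longleftrightarrow> is_leaf \<tau> v"
proof -
  have "v \<in> verts \<tau>" using assms by (simp add: inner_verts_def)
  moreover have "\<phi> v \<in> inner_verts \<tau>'"
    using iso_inner[OF assms(1,2)] assms(3) by (auto simp: bij_betw_def)
  ultimately show ?thesis
    using iso_children[OF assms(1,2), of v] assms(3)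
    by (auto simp: is_leaf_def bij_betw_def)
qed

lemma wf_remove:
  assumes wf: "exotic_wf \<tau>" and leaf: "\<forall>v\<in>X. is_leaf \<tau> v"
    and X: "X \<in> pairing \<tau> \<or> X \<inter> coloured_verts Beta \<tau> = {}"
  shows "exotic_wf (remove_verts \<tau> X)"
proof -
  let ?\<tau> = "remove_verts \<tau> X"
  have root: "troot \<tau> \<notin> X" using leaf by (auto simp: is_leaf_def inner_verts_def)
  have inner: "inner_verts ?\<tau> = inner_verts \<tau> - X"
    by (auto simp: inner_verts_def remove_verts_def)
  have par: "parent \<tau> v \<in> verts \<tau> - X" if "v \<in> inner_verts \<tau>" for v
    using that wf leaf unfolding is_leaf_def children_def exotic_wf_def by blast
  have col: "coloured_verts Beta ?\<tau> = coloured_verts Beta \<tau> - X"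
    by (auto simp: coloured_verts_def inner) (auto simp: remove_verts_def)
  have part: "partition_on (coloured_verts Beta \<tau>) (pairing \<tau>)"
    using wf by (simp add: exotic_wf_def)
  have Un: "\<Union> (pairing \<tau>) = coloured_verts Beta \<tau>"
    and dj: "\<And>p q. p \<in> pairing \<tau> \<Longrightarrow> q \<in> pairing \<tau> \<Longrightarrow> p \<noteq> q \<Longrightarrow> p \<inter> q = {}"
    using part by (auto simp: partition_on_def disjoint_def)
  have "\<Union> {p \<in> pairing \<tau>. p \<inter> X = {}} = coloured_verts Beta \<tau> - X"
  proof (cases "X \<in> pairing \<tau>")
    case True
    then show ?thesis unfolding Un[symmetric] using dj by blast
  next
    case False
    then show ?thesis unfolding Un[symmetric] using X Un by blast
  qed
  then have part': "partition_on (coloured_verts Beta \<tau> - X) {p \<in> pairing \<tau>. p \<inter> X = {}}"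
    using part by (auto simp: partition_on_def disjoint_def)
  show ?thesis
    unfolding exotic_wf_def inner col
  proof (intro conjI ballI)
    show "finite (verts ?\<tau>)" "troot ?\<tau> \<in> verts ?\<tau>"
      using wf root by (auto simp: exotic_wf_def remove_verts_def)
    show "partition_on (coloured_verts Beta \<tau> - X) (pairing ?\<tau>)"
      using part' by (simp add: remove_verts_def)
    show "card p = 2" if "p \<in> pairing ?\<tau>" for p
      using wf that by (simp add: exotic_wf_def remove_verts_def)
    show "parent ?\<tau> v \<in> verts ?\<tau>" if "v \<in> inner_verts \<tau> - X" for v
      using par that by (simp add: remove_verts_def)
    show "\<exists>k. (parent ?\<tau> ^^ k) v = troot ?\<tau>" if "v \<in> verts ?\<tau>" for v
      using wf that by (simp add: exotic_wf_def remove_verts_def)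
  qed
qed

lemma pairing_remove: "pairing (remove_verts \<tau> X) = {p \<in> pairing \<tau>. p \<inter> X = {}}"
  by (simp add: remove_verts_def)

lemma iso_remove:
  assumes "exotic_iso \<phi> \<tau> \<tau>'" "exotic_wf \<tau>" "X \<subseteq> inner_verts \<tau>"
  shows "exotic_iso \<phi> (remove_verts \<tau> X) (remove_verts \<tau>' (\<phi> ` X))"
proof -
  have b: "bij_betw \<phi> (verts \<tau>) (verts \<tau>')" using assms by (simp add: exotic_iso_def)
  have X: "X \<subseteq> verts \<tau>" using assms(3) by (auto simp: inner_verts_def)
  have b': "bij_betw \<phi> (verts \<tau> - X) (verts \<tau>' - \<phi> ` X)"
    using b X by (rule bij_betw_Diff_image)
  have disj: "\<phi> ` p \<inter> \<phi> ` X = {} \<longleftrightarrow> p \<inter> X = {}" if "p \<in> pairing \<tau>" for p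
  proof -
    have "\<phi> ` (p \<inter> X) = \<phi> ` p \<inter> \<phi> ` X"
      using b X pairing_subset(3)[OF assms(2) that]
      by (intro inj_on_image_Int[where C = "verts \<tau>"]) (auto simp: bij_betw_def)
    then show ?thesis by (metis image_is_empty)
  qed
  have p: "(\<lambda>p. \<phi> ` p) ` pairing \<tau> = pairing \<tau>'" using assms by (simp add: exotic_iso_def)
  have pairs: "(\<lambda>p. \<phi> ` p) ` {p \<in> pairing \<tau>. p \<inter> X = {}} = {p \<in> pairing \<tau>'. p \<inter> \<phi> ` X = {}}"
    unfolding p[symmetric] using disj by auto
  have inner: "inner_verts (remove_verts \<tau> X) \<subseteq> inner_verts \<tau>"
    by (auto simp: remove_verts_def inner_verts_def)
  show ?thesis
    unfolding exotic_iso_def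
  proof (intro conjI ballI)
    show "bij_betw \<phi> (verts (remove_verts \<tau> X)) (verts (remove_verts \<tau>' (\<phi> ` X)))"
      using b' by (simp add: remove_verts_def)
    show "\<phi> (troot (remove_verts \<tau> X)) = troot (remove_verts \<tau>' (\<phi> ` X))"
      using assms(1) by (simp add: remove_verts_def exotic_iso_def)
    show "(\<lambda>p. \<phi> ` p) ` pairing (remove_verts \<tau> X) = pairing (remove_verts \<tau>' (\<phi> ` X))"
      using pairs by (simp only: pairing_remove)
    fix v assume "v \<in> inner_verts (remove_verts \<tau> X)"
    then have v: "v \<in> inner_verts \<tau>" using inner by blast
    then show "\<phi> (parent (remove_verts \<tau> X) v) = parent (remove_verts \<tau>' (\<phi> ` X)) (\<phi> v)"
      "vcolour (remove_verts \<tau>' (\<phi> ` X)) (\<phi> v) = vcolour (remove_verts \<tau> X) v"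
      using assms(1) by (simp_all add: remove_verts_def exotic_iso_def)
  qed
qed


section \<open>Isomorphism classes and their invariants\<close>

quotient_type exotic_tree = pre_tree / partial: exotic_equiv
  by (rule part_equivp_exotic_equiv)

lemma card_coloured_cong:
  assumes "exotic_equiv \<tau> \<tau>'"
  shows "card (coloured_verts c \<tau>) = card (coloured_verts c \<tau>')"
  using assms by (rule exotic_equivE) (rule bij_betw_same_card[OF iso_coloured])

lift_definition tree_order :: "exotic_tree \<Rightarrow> nat" is
  "\<lambda>\<tau>. card (coloured_verts Alpha \<tau>) + card (coloured_verts Beta \<tau>) div 2 + 1"
  by (simp add: card_coloured_cong)

lemma card_auto_le:
  assumes iso: "exotic_iso \<phi> \<tau> \<tau>'" and wf: "exotic_wf \<tau>" "exotic_wf \<tau>'"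
  shows "card {\<psi>. \<psi> permutes verts \<tau> \<and> exotic_iso \<psi> \<tau> \<tau>}
       \<le> card {\<psi>. \<psi> permutes verts \<tau>' \<and> exotic_iso \<psi> \<tau>' \<tau>'}"
proof -
  define i where "i = inv_into (verts \<tau>) \<phi>"
  define h where "h \<psi> v = (if v \<in> verts \<tau>' then \<phi> (\<psi> (i v)) else v)" for \<psi> v
  have b: "bij_betw \<phi> (verts \<tau>) (verts \<tau>')" using iso by (simp add: exotic_iso_def)
  have i: "exotic_iso i \<tau>' \<tau>" unfolding i_def by (rule exotic_iso_sym[OF iso wf(1)])
  have inv: "i (\<phi> v) = v" if "v \<in> verts \<tau>" for v
    using b that by (simp add: bij_betw_def i_def)
  show ?thesis
  proof (rule card_inj_on_le[where f = h])
    show "inj_on h {\<psi>. \<psi> permutes verts \<tau> \<and> exotic_iso \<psi> \<tau> \<tau>}"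
    proof (rule inj_onI, rule ext)
      fix \<psi> \<psi>' v
      assume "\<psi> \<in> {\<psi>. \<psi> permutes verts \<tau> \<and> exotic_iso \<psi> \<tau> \<tau>}"
        "\<psi>' \<in> {\<psi>. \<psi> permutes verts \<tau> \<and> exotic_iso \<psi> \<tau> \<tau>}" and eq: "h \<psi> = h \<psi>'"
      then have A: "\<psi> permutes verts \<tau>" "\<psi>' permutes verts \<tau>" by simp_all
      show "\<psi> v = \<psi>' v"
      proof (cases "v \<in> verts \<tau>")
        case True
        then have "\<phi> v \<in> verts \<tau>'" using bij_betwE[OF b] by simp
        then have "\<phi> (\<psi> v) = \<phi> (\<psi>' v)"
          using fun_cong[OF eq, of "\<phi> v"] inv[OF True] by (simp add: h_def)
        moreover have "\<psi> v \<in> verts \<tau>" "\<psi>' v \<in> verts \<tau>"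
          using True by (simp_all add: permutes_in_image[OF A(1)] permutes_in_image[OF A(2)])
        ultimately show ?thesis by (rule inj_onD[OF bij_betw_imp_inj_on[OF b]])
      next
        case False
        then show ?thesis
          by (simp add: permutes_not_in[OF A(1)] permutes_not_in[OF A(2)])
      qed
    qed
    show "h ` {\<psi>. \<psi> permutes verts \<tau> \<and> exotic_iso \<psi> \<tau> \<tau>}
        \<subseteq> {\<psi>. \<psi> permutes verts \<tau>' \<and> exotic_iso \<psi> \<tau>' \<tau>'}"
    proof (rule image_subsetI)
      fix \<psi> assume "\<psi> \<in> {\<psi>. \<psi> permutes verts \<tau> \<and> exotic_iso \<psi> \<tau> \<tau>}"
      then have \<psi>: "exotic_iso \<psi> \<tau> \<tau>" by simp
      have "exotic_iso (\<phi> \<circ> (\<psi> \<circ> i)) \<tau>' \<tau>'"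
        by (rule exotic_iso_trans[OF exotic_iso_trans[OF i \<psi> wf(2)] iso wf(2)])
      then have h: "exotic_iso (h \<psi>) \<tau>' \<tau>'"
        by (rule exotic_iso_cong) (simp_all add: wf h_def)
      then have "bij_betw (h \<psi>) (verts \<tau>') (verts \<tau>')" by (simp add: exotic_iso_def)
      then have "h \<psi> permutes verts \<tau>'"
        by (rule bij_imp_permutes) (simp add: h_def)
      with h show "h \<psi> \<in> {\<psi>. \<psi> permutes verts \<tau>' \<and> exotic_iso \<psi> \<tau>' \<tau>'}" by simp
    qed
    have "finite {\<psi>. \<psi> permutes verts \<tau>'}"
      using wf by (intro finite_permutations) (simp add: exotic_wf_def)
    then show "finite {\<psi>. \<psi> permutes verts \<tau>' \<and> exotic_iso \<psi> \<tau>' \<tau>'}"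
      by (rule rev_finite_subset) auto
  qed
qed

lemma auto_count_le:
  assumes "exotic_equiv \<tau> \<tau>'"
  shows "card {\<psi>. \<psi> permutes verts \<tau> \<and> exotic_iso \<psi> \<tau> \<tau>}
       \<le> card {\<psi>. \<psi> permutes verts \<tau>' \<and> exotic_iso \<psi> \<tau>' \<tau>'}"
  using assms by (rule exotic_equivE) (rule card_auto_le)

text \<open>Automorphisms are extended by the identity outside the vertex set, so that each one is
  counted once.\<close>

lift_definition symmetry_factor :: "exotic_tree \<Rightarrow> nat" is
  "\<lambda>\<tau>. card {\<phi>. \<phi> permutes verts \<tau> \<and> exotic_iso \<phi> \<tau> \<tau>}"
  by (rule order_antisym; rule auto_count_le) (assumption | rule exotic_equiv_sym, assumption)+

lemma removal_count_le:
  assumes iso: "exotic_iso \<phi> \<tau> \<tau>'" and wf: "exotic_wf \<tau>" and equiv: "exotic_equiv \<sigma> \<sigma>'"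
    and fin: "finite B" and inj: "inj_on g A" and gB: "g ` A \<subseteq> B"
    and S: "\<And>a. a \<in> A \<Longrightarrow> S a \<subseteq> inner_verts \<tau> \<and> S (g a) = \<phi> ` S a"
    and A: "\<And>a. a \<in> A \<Longrightarrow> exotic_wf (remove_verts \<tau> (S a))"
    and B: "\<And>b. b \<in> B \<Longrightarrow> exotic_wf (remove_verts \<tau>' (S b))"
  shows "card {a \<in> A. exotic_equiv (remove_verts \<tau> (S a)) \<sigma>}
       \<le> card {b \<in> B. exotic_equiv (remove_verts \<tau>' (S b)) \<sigma>'}"
proof (rule card_inj_on_le[where f = g])
  show "inj_on g {a \<in> A. exotic_equiv (remove_verts \<tau> (S a)) \<sigma>}"
    using inj by (rule inj_on_subset) auto
  show "g ` {a \<in> A. exotic_equiv (remove_verts \<tau> (S a)) \<sigma>}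
      \<subseteq> {b \<in> B. exotic_equiv (remove_verts \<tau>' (S b)) \<sigma>'}"
  proof (rule image_subsetI)
    fix a assume a: "a \<in> {a \<in> A. exotic_equiv (remove_verts \<tau> (S a)) \<sigma>}"
    have "exotic_iso \<phi> (remove_verts \<tau> (S a)) (remove_verts \<tau>' (\<phi> ` S a))"
      using iso_remove[OF iso wf] S a by blast
    then have "exotic_equiv (remove_verts \<tau> (S a)) (remove_verts \<tau>' (S (g a)))"
      using a gB A[of a] B[of "g a"] S[of a] by (auto simp: exotic_equiv_def)
    then show "g a \<in> {b \<in> B. exotic_equiv (remove_verts \<tau>' (S b)) \<sigma>'}"
      using a gB equiv exotic_equiv_sym exotic_equiv_trans by blast
  qed
qed (use fin in simp)

definition alpha_leaves :: "pre_tree \<Rightarrow> nat set" where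
  "alpha_leaves \<tau> = {v \<in> coloured_verts Alpha \<tau>. is_leaf \<tau> v}"

definition beta_leaf_pairs :: "pre_tree \<Rightarrow> nat set set" where
  "beta_leaf_pairs \<tau> = {p \<in> pairing \<tau>. \<forall>v\<in>p. is_leaf \<tau> v}"

lemma finite_coloured: "exotic_wf \<tau> \<Longrightarrow> finite (coloured_verts c \<tau>)"
  by (auto simp: exotic_wf_def coloured_verts_def inner_verts_def)

lemma finite_alpha_leaves: "exotic_wf \<tau> \<Longrightarrow> finite (alpha_leaves \<tau>)"
  by (simp add: alpha_leaves_def finite_coloured)

lemma finite_beta_leaf_pairs: "exotic_wf \<tau> \<Longrightarrow> finite (beta_leaf_pairs \<tau>)"
proof -
  assume "exotic_wf \<tau>"
  then have "beta_leaf_pairs \<tau> \<subseteq> Pow (coloured_verts Beta \<tau>)" "finite (coloured_verts Beta \<tau>)"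
    using pairing_subset finite_coloured by (auto simp: beta_leaf_pairs_def)
  then show ?thesis by (meson finite_Pow_iff finite_subset)
qed

lemma wf_remove_alpha: "exotic_wf \<tau> \<Longrightarrow> v \<in> alpha_leaves \<tau> \<Longrightarrow> exotic_wf (remove_verts \<tau> {v})"
  by (rule wf_remove) (auto simp: alpha_leaves_def coloured_verts_def)

lemma wf_remove_beta: "exotic_wf \<tau> \<Longrightarrow> p \<in> beta_leaf_pairs \<tau> \<Longrightarrow> exotic_wf (remove_verts \<tau> p)"
  by (rule wf_remove) (auto simp: beta_leaf_pairs_def)

lemma alpha_count_le:
  assumes "exotic_equiv \<sigma> \<sigma>'" "exotic_equiv \<tau> \<tau>'"
  shows "card {v \<in> alpha_leaves \<tau>. exotic_equiv (remove_verts \<tau> {v}) \<sigma>}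
       \<le> card {v \<in> alpha_leaves \<tau>'. exotic_equiv (remove_verts \<tau>' {v}) \<sigma>'}"
proof -
  obtain \<phi> where \<phi>: "exotic_iso \<phi> \<tau> \<tau>'" and wf: "exotic_wf \<tau>" "exotic_wf \<tau>'"
    using assms(2) by (rule exotic_equivE)
  have b: "bij_betw \<phi> (coloured_verts Alpha \<tau>) (coloured_verts Alpha \<tau>')"
    by (rule iso_coloured[OF \<phi> wf(1)])
  have sub: "alpha_leaves \<tau> \<subseteq> coloured_verts Alpha \<tau>" "coloured_verts Alpha \<tau> \<subseteq> inner_verts \<tau>"
    by (auto simp: alpha_leaves_def coloured_verts_def)
  show ?thesis
  proof (rule removal_count_le[OF \<phi> wf(1) assms(1), where g = \<phi>])
    show "inj_on \<phi> (alpha_leaves \<tau>)"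
      using b sub by (meson bij_betw_imp_inj_on inj_on_subset)
    show "\<phi> ` alpha_leaves \<tau> \<subseteq> alpha_leaves \<tau>'"
      using b sub iso_leaf[OF \<phi> wf(1)] unfolding alpha_leaves_def bij_betw_def by blast
    show "finite (alpha_leaves \<tau>')" by (rule finite_alpha_leaves[OF wf(2)])
    show "{v} \<subseteq> inner_verts \<tau> \<and> {\<phi> v} = \<phi> ` {v}" if "v \<in> alpha_leaves \<tau>" for v
      using that sub by blast
    show "exotic_wf (remove_verts \<tau> {v})" if "v \<in> alpha_leaves \<tau>" for v
      using wf(1) that by (rule wf_remove_alpha)
    show "exotic_wf (remove_verts \<tau>' {v})" if "v \<in> alpha_leaves \<tau>'" for v
      using wf(2) that by (rule wf_remove_alpha)
  qed
qed

lemma beta_count_le: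
  assumes "exotic_equiv \<sigma> \<sigma>'" "exotic_equiv \<tau> \<tau>'"
  shows "card {p \<in> beta_leaf_pairs \<tau>. exotic_equiv (remove_verts \<tau> p) \<sigma>}
       \<le> card {p \<in> beta_leaf_pairs \<tau>'. exotic_equiv (remove_verts \<tau>' p) \<sigma>'}"
proof -
  obtain \<phi> where \<phi>: "exotic_iso \<phi> \<tau> \<tau>'" and wf: "exotic_wf \<tau>" "exotic_wf \<tau>'"
    using assms(2) by (rule exotic_equivE)
  have sub: "p \<subseteq> inner_verts \<tau>" if "p \<in> beta_leaf_pairs \<tau>" for p
    using that pairing_subset(2)[OF wf(1)] by (auto simp: beta_leaf_pairs_def)
  have inj: "inj_on \<phi> (inner_verts \<tau>)" using iso_inner[OF \<phi> wf(1)] by (rule bij_betw_imp_inj_on)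
  show ?thesis
  proof (rule removal_count_le[OF \<phi> wf(1) assms(1), where g = "\<lambda>p. \<phi> ` p" and S = "\<lambda>p. p"])
    show "inj_on (\<lambda>p. \<phi> ` p) (beta_leaf_pairs \<tau>)"
      using inj_on_image_Pow[OF inj] by (rule inj_on_subset) (use sub in blast)
    show "(\<lambda>p. \<phi> ` p) ` beta_leaf_pairs \<tau> \<subseteq> beta_leaf_pairs \<tau>'"
    proof (rule image_subsetI)
      fix p assume p: "p \<in> beta_leaf_pairs \<tau>"
      then have "\<phi> ` p \<in> pairing \<tau>'"
        using \<phi> by (auto simp: beta_leaf_pairs_def exotic_iso_def)
      moreover have "\<forall>v\<in>p. is_leaf \<tau>' (\<phi> v)"
        using p iso_leaf[OF \<phi> wf(1)] sub[OF p] by (auto simp: beta_leaf_pairs_def)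
      ultimately show "\<phi> ` p \<in> beta_leaf_pairs \<tau>'" by (simp add: beta_leaf_pairs_def)
    qed
    show "finite (beta_leaf_pairs \<tau>')" by (rule finite_beta_leaf_pairs[OF wf(2)])
    show "p \<subseteq> inner_verts \<tau> \<and> \<phi> ` p = \<phi> ` p" if "p \<in> beta_leaf_pairs \<tau>" for p
      using sub[OF that] by simp
    show "exotic_wf (remove_verts \<tau> p)" if "p \<in> beta_leaf_pairs \<tau>" for p
      using wf(1) that by (rule wf_remove_beta)
    show "exotic_wf (remove_verts \<tau>' p)" if "p \<in> beta_leaf_pairs \<tau>'" for p
      using wf(2) that by (rule wf_remove_beta)
  qed
qed

lift_definition m_alpha :: "exotic_tree \<Rightarrow> exotic_tree \<Rightarrow> nat" is
  "\<lambda>\<tau>' \<tau>. card {v \<in> alpha_leaves \<tau>. exotic_equiv (remove_verts \<tau> {v}) \<tau>'}"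
  by (rule order_antisym; rule alpha_count_le) (assumption | rule exotic_equiv_sym, assumption)+

lift_definition m_beta :: "exotic_tree \<Rightarrow> exotic_tree \<Rightarrow> nat" is
  "\<lambda>\<tau>' \<tau>. card {p \<in> beta_leaf_pairs \<tau>. exotic_equiv (remove_verts \<tau> p) \<tau>'}"
  by (rule order_antisym; rule beta_count_le) (assumption | rule exotic_equiv_sym, assumption)+

lemma tree_order_alpha:
  "m_alpha \<tau>' \<tau> \<noteq> 0 \<Longrightarrow> tree_order \<tau>' < tree_order \<tau>"
proof transfer
  fix \<tau>' \<tau>
  assume "exotic_equiv \<tau> \<tau>" and
    "card {v \<in> alpha_leaves \<tau>. exotic_equiv (remove_verts \<tau> {v}) \<tau>'} \<noteq> 0"
  then obtain v where v: "v \<in> alpha_leaves \<tau>" "exotic_equiv (remove_verts \<tau> {v}) \<tau>'"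
    and wf: "exotic_wf \<tau>"
    by (auto simp: exotic_equiv_def card_eq_0_iff)
  have eq: "card (coloured_verts c \<tau>') = card (coloured_verts c (remove_verts \<tau> {v}))" for c
    using card_coloured_cong[OF v(2)] by simp
  have A: "coloured_verts c (remove_verts \<tau> {v}) = coloured_verts c \<tau> - {v}" for c
    by (auto simp: coloured_verts_def inner_verts_def remove_verts_def)
  have "v \<in> coloured_verts Alpha \<tau>" "v \<notin> coloured_verts Beta \<tau>"
    using v(1) by (auto simp: alpha_leaves_def coloured_verts_def)
  then show "card (coloured_verts Alpha \<tau>') + card (coloured_verts Beta \<tau>') div 2 + 1
       < card (coloured_verts Alpha \<tau>) + card (coloured_verts Beta \<tau>) div 2 + 1"
    unfolding eq A using card_Diff1_less[OF finite_coloured[OF wf]] by simp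
qed

lemma tree_order_beta:
  "m_beta \<tau>' \<tau> \<noteq> 0 \<Longrightarrow> tree_order \<tau>' < tree_order \<tau>"
proof transfer
  fix \<tau>' \<tau>
  assume "exotic_equiv \<tau> \<tau>" and
    "card {p \<in> beta_leaf_pairs \<tau>. exotic_equiv (remove_verts \<tau> p) \<tau>'} \<noteq> 0"
  then obtain p where p: "p \<in> beta_leaf_pairs \<tau>" "exotic_equiv (remove_verts \<tau> p) \<tau>'"
    and wf: "exotic_wf \<tau>"
    by (auto simp: exotic_equiv_def card_eq_0_iff)
  have eq: "card (coloured_verts c \<tau>') = card (coloured_verts c (remove_verts \<tau> p))" for c
    using card_coloured_cong[OF p(2)] by simp
  have A: "coloured_verts c (remove_verts \<tau> p) = coloured_verts c \<tau> - p" for c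
    by (auto simp: coloured_verts_def inner_verts_def remove_verts_def)
  have sub: "p \<subseteq> coloured_verts Beta \<tau>" and two: "card p = 2"
    using p(1) wf pairing_subset by (auto simp: beta_leaf_pairs_def exotic_wf_def)
  then have "coloured_verts Alpha \<tau> - p = coloured_verts Alpha \<tau>"
    by (auto simp: coloured_verts_def)
  moreover have "card (coloured_verts Beta \<tau> - p) = card (coloured_verts Beta \<tau>) - 2"
    using sub two finite_coloured[OF wf] by (metis card_Diff_subset finite_subset)
  moreover have "card (coloured_verts Beta \<tau>) \<ge> 2"
    using sub two finite_coloured[OF wf] by (metis card_mono)
  ultimately show "card (coloured_verts Alpha \<tau>') + card (coloured_verts Beta \<tau>') div 2 + 1
       < card (coloured_verts Alpha \<tau>) + card (coloured_verts Beta \<tau>) div 2 + 1"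
    unfolding eq A by simp
qed

text \<open>
  The number \<open>1/\<tau>!\<close>, which may vanish. Restricting the sums over all isomorphism classes to the
  classes of nonzero multiplicity makes them finite; the omitted terms are zero.
\<close>

function inverse_tree_factorial :: "exotic_tree \<Rightarrow> real" where
  "inverse_tree_factorial \<tau> =
     (if tree_order \<tau> > 1 then
        ((\<Sum>\<tau>' | m_alpha \<tau>' \<tau> \<noteq> 0. real (m_alpha \<tau>' \<tau>) * inverse_tree_factorial \<tau>') +
         (\<Sum>\<tau>' | m_beta \<tau>' \<tau> \<noteq> 0. real (m_beta \<tau>' \<tau>) * inverse_tree_factorial \<tau>'))
        / real (tree_order \<tau>)
      else 1)"
  by pat_completeness auto
termination
  by (relation "Wellfounded.measure tree_order") (auto intro: tree_order_alpha tree_order_beta)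

declare inverse_tree_factorial.simps [simp del]

lemma rep_exotic_tree_refl: "exotic_equiv (rep_exotic_tree \<tau>) (rep_exotic_tree \<tau>)"
  by (rule Quotient3_rep_reflp[OF Quotient3_exotic_tree])

lemma abs_rep_exotic_tree: "abs_exotic_tree (rep_exotic_tree \<tau>) = \<tau>"
  by (rule Quotient3_abs_rep[OF Quotient3_exotic_tree])

lemma finite_m_alpha: "finite {\<tau>'. m_alpha \<tau>' \<tau> \<noteq> 0}"
proof -
  define t where "t = rep_exotic_tree \<tau>"
  have t: "exotic_equiv t t" "\<tau> = abs_exotic_tree t"
    unfolding t_def by (simp_all add: rep_exotic_tree_refl abs_rep_exotic_tree)
  have "\<tau>' \<in> (\<lambda>v. abs_exotic_tree (remove_verts t {v})) ` alpha_leaves t"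
    if nz: "m_alpha \<tau>' \<tau> \<noteq> 0" for \<tau>'
  proof -
    define t' where "t' = rep_exotic_tree \<tau>'"
    have t': "exotic_equiv t' t'" "\<tau>' = abs_exotic_tree t'"
      unfolding t'_def by (simp_all add: rep_exotic_tree_refl abs_rep_exotic_tree)
    have "{v \<in> alpha_leaves t. exotic_equiv (remove_verts t {v}) t'} \<noteq> {}"
      using nz unfolding t(2) t'(2) m_alpha.abs_eq[OF t'(1) t(1)] by (metis card.empty)
    then obtain v where v: "v \<in> alpha_leaves t" "exotic_equiv (remove_verts t {v}) t'"
      by blast
    have "abs_exotic_tree (remove_verts t {v}) = \<tau>'"
      unfolding t'(2) by (rule Quotient3_rel_abs[OF Quotient3_exotic_tree v(2)])
    with v(1) show ?thesis by blast
  qed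
  then have "{\<tau>'. m_alpha \<tau>' \<tau> \<noteq> 0} \<subseteq> (\<lambda>v. abs_exotic_tree (remove_verts t {v})) ` alpha_leaves t"
    by blast
  moreover have "finite (alpha_leaves t)"
    using t(1) by (intro finite_alpha_leaves) (simp add: exotic_equiv_def)
  ultimately show ?thesis
    by (meson finite_imageI finite_subset)
qed

lemma finite_m_beta: "finite {\<tau>'. m_beta \<tau>' \<tau> \<noteq> 0}"
proof -
  define t where "t = rep_exotic_tree \<tau>"
  have t: "exotic_equiv t t" "\<tau> = abs_exotic_tree t"
    unfolding t_def by (simp_all add: rep_exotic_tree_refl abs_rep_exotic_tree)
  have "\<tau>' \<in> (\<lambda>p. abs_exotic_tree (remove_verts t p)) ` beta_leaf_pairs t"
    if nz: "m_beta \<tau>' \<tau> \<noteq> 0" for \<tau>'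
  proof -
    define t' where "t' = rep_exotic_tree \<tau>'"
    have t': "exotic_equiv t' t'" "\<tau>' = abs_exotic_tree t'"
      unfolding t'_def by (simp_all add: rep_exotic_tree_refl abs_rep_exotic_tree)
    have "{p \<in> beta_leaf_pairs t. exotic_equiv (remove_verts t p) t'} \<noteq> {}"
      using nz unfolding t(2) t'(2) m_beta.abs_eq[OF t'(1) t(1)] by (metis card.empty)
    then obtain p where p: "p \<in> beta_leaf_pairs t" "exotic_equiv (remove_verts t p) t'"
      by blast
    have "abs_exotic_tree (remove_verts t p) = \<tau>'"
      unfolding t'(2) by (rule Quotient3_rel_abs[OF Quotient3_exotic_tree p(2)])
    with p(1) show ?thesis by blast
  qed
  then have "{\<tau>'. m_beta \<tau>' \<tau> \<noteq> 0} \<subseteq> (\<lambda>p. abs_exotic_tree (remove_verts t p)) ` beta_leaf_pairs t"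
    by blast
  moreover have "finite (beta_leaf_pairs t)"
    using t(1) by (intro finite_beta_leaf_pairs) (simp add: exotic_equiv_def)
  ultimately show ?thesis
    by (meson finite_imageI finite_subset)
qed

lift_definition elementary_differential ::
    "(real \<Rightarrow> real) \<Rightarrow> (real \<Rightarrow> real) \<Rightarrow> (real \<Rightarrow> real) \<Rightarrow> real \<Rightarrow> exotic_tree \<Rightarrow> real" is
  "\<lambda>\<alpha> \<beta> f x \<tau>. (deriv ^^ card (children \<tau> (troot \<tau>))) f x *
     (\<Prod>v\<in>inner_verts \<tau>.
        (deriv ^^ card (children \<tau> v)) (case vcolour \<tau> v of Alpha \<Rightarrow> \<alpha> | Beta \<Rightarrow> \<beta>) x)"
proof -
  fix \<alpha> \<beta> f :: "real \<Rightarrow> real" and x :: real and \<tau> \<tau>'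
  assume "exotic_equiv \<tau> \<tau>'"
  then obtain \<phi> where \<phi>: "exotic_iso \<phi> \<tau> \<tau>'" and wf: "exotic_wf \<tau>" "exotic_wf \<tau>'"
    by (rule exotic_equivE)
  have c: "card (children \<tau>' (\<phi> v)) = card (children \<tau> v)" if "v \<in> verts \<tau>" for v
    using bij_betw_same_card[OF iso_children[OF \<phi> wf(1) that]] by simp
  have r: "\<phi> (troot \<tau>) = troot \<tau>'" "troot \<tau> \<in> verts \<tau>"
    using \<phi> wf by (auto simp: exotic_iso_def exotic_wf_def)
  have col: "vcolour \<tau>' (\<phi> v) = vcolour \<tau> v" "v \<in> verts \<tau>" if "v \<in> inner_verts \<tau>" for v
    using \<phi> that by (auto simp: exotic_iso_def inner_verts_def)
  let ?F = "\<lambda>\<tau> v. (deriv ^^ card (children \<tau> v)) (case vcolour \<tau> v of Alpha \<Rightarrow> \<alpha> | Beta \<Rightarrow> \<beta>) x"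
  have "(\<Prod>v\<in>inner_verts \<tau>. ?F \<tau> v) = (\<Prod>v\<in>inner_verts \<tau>. ?F \<tau>' (\<phi> v))"
    using col c by (intro prod.cong) auto
  also have "\<dots> = (\<Prod>v\<in>inner_verts \<tau>'. ?F \<tau>' v)"
    by (rule prod.reindex_bij_betw[OF iso_inner[OF \<phi> wf(1)]])
  finally show "(deriv ^^ card (children \<tau> (troot \<tau>))) f x * (\<Prod>v\<in>inner_verts \<tau>. ?F \<tau> v) =
      (deriv ^^ card (children \<tau>' (troot \<tau>'))) f x * (\<Prod>v\<in>inner_verts \<tau>'. ?F \<tau>' v)"
    using c[OF r(2)] r(1) by simp
qed


section \<open>The formal expectation\<close>

definition generator :: "(real \<Rightarrow> real) \<Rightarrow> (real \<Rightarrow> real) \<Rightarrow> (real \<Rightarrow> real) \<Rightarrow> real \<Rightarrow> real" where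
  "generator \<alpha> \<beta> g x = \<alpha> x * deriv g x + (\<beta> x)\<^sup>2 / 2 * (deriv ^^ 2) g x"

text \<open>
  The Feller semigroup applied to \<open>f\<close>, at \<open>u\<^sub>0\<close>, as a formal power series in \<open>t\<close>: the Ito-Taylor
  series obtained by iterating Ito's formula and taking expectations.
\<close>

definition ito_taylor_series ::
    "(real \<Rightarrow> real) \<Rightarrow> (real \<Rightarrow> real) \<Rightarrow> (real \<Rightarrow> real) \<Rightarrow> real \<Rightarrow> real fps" where
  "ito_taylor_series \<alpha> \<beta> f u\<^sub>0 = Abs_fps (\<lambda>k. (generator \<alpha> \<beta> ^^ k) f u\<^sub>0 / fact k)"

definition smooth :: "(real \<Rightarrow> real) \<Rightarrow> bool" where
  "smooth g \<longleftrightarrow> (\<forall>n x. (deriv ^^ n) g differentiable at x)"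

definition real_analytic :: "(real \<Rightarrow> real) \<Rightarrow> bool" where
  "real_analytic g \<longleftrightarrow> (\<forall>x. \<exists>F. (\<lambda>h. g (x + h)) has_fps_expansion F)"


section \<open>Ito stochastic differential equations\<close>

locale wiener_process = prob_space M + filtration "space M" F
  for M :: "'a measure" and F :: "real \<Rightarrow> 'a measure" and W :: "real \<Rightarrow> 'a \<Rightarrow> real" +
  assumes subalg: "\<And>t. subalgebra M (F t)"
    and adapted: "\<And>t. 0 \<le> t \<Longrightarrow> W t \<in> borel_measurable (F t)"
    and start: "AE \<omega> in M. W 0 \<omega> = 0"
    and continuous_paths: "\<And>\<omega>. \<omega> \<in> space M \<Longrightarrow> continuous_on {0..} (\<lambda>t. W t \<omega>)"
    and normal_increments: "\<And>s t. 0 \<le> s \<Longrightarrow> s < t \<Longrightarrow>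
      distributed M lborel (\<lambda>\<omega>. W t \<omega> - W s \<omega>) (normal_density 0 (sqrt (t - s)))"
    and indep_increments: "\<And>s t. 0 \<le> s \<Longrightarrow> s < t \<Longrightarrow>
      indep_set (sets (F s)) (sets (vimage_algebra (space M) (\<lambda>\<omega>. W t \<omega> - W s \<omega>) borel))"

definition tendsto_in_prob :: "'a measure \<Rightarrow> (nat \<Rightarrow> 'a \<Rightarrow> real) \<Rightarrow> ('a \<Rightarrow> real) \<Rightarrow> bool" where
  "tendsto_in_prob M X Y \<longleftrightarrow>
     (\<forall>n. X n \<in> borel_measurable M) \<and> Y \<in> borel_measurable M \<and>
     (\<forall>\<epsilon>>0. (\<lambda>n. measure M {\<omega> \<in> space M. \<bar>X n \<omega> - Y \<omega>\<bar> > \<epsilon>}) \<longlonglongrightarrow> 0)"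

text \<open>
  \<open>(m, r, \<xi>)\<close> stands for the simple process that equals \<open>\<xi> i\<close> on \<open>{r i<..r (Suc i)}\<close> for
  \<open>i < m\<close> and vanishes elsewhere.
\<close>

type_synonym 'a simple_process = "nat \<times> (nat \<Rightarrow> real) \<times> (nat \<Rightarrow> 'a \<Rightarrow> real)"

fun simple_process :: "(real \<Rightarrow> 'a measure) \<Rightarrow> real \<Rightarrow> 'a simple_process \<Rightarrow> bool" where
  "simple_process F t (m, r, \<xi>) \<longleftrightarrow>
     (\<forall>i\<le>m. 0 \<le> r i \<and> r i \<le> t) \<and> (\<forall>i<m. r i \<le> r (Suc i)) \<and>
     (\<forall>i<m. \<xi> i \<in> borel_measurable (F (r i)) \<and> (\<exists>C. \<forall>\<omega>\<in>space (F (r i)). \<bar>\<xi> i \<omega>\<bar> \<le> C))"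

fun simple_value :: "'a simple_process \<Rightarrow> real \<Rightarrow> 'a \<Rightarrow> real" where
  "simple_value (m, r, \<xi>) s \<omega> = (\<Sum>i<m. \<xi> i \<omega> * indicator {r i<..r (Suc i)} s)"

fun simple_integral :: "(real \<Rightarrow> 'a \<Rightarrow> real) \<Rightarrow> 'a simple_process \<Rightarrow> 'a \<Rightarrow> real" where
  "simple_integral W (m, r, \<xi>) \<omega> = (\<Sum>i<m. \<xi> i \<omega> * (W (r (Suc i)) \<omega> - W (r i) \<omega>))"

text \<open>
  \<open>I\<close> is a version of the Ito integral of \<open>H\<close> against \<open>W\<close> over \<open>[0, t]\<close>, for integrands that are
  almost surely square integrable in time: the integrals of simple processes that approximate \<open>H\<close>
  in \<open>L\<^sup>2([0, t])\<close> in probability converge to \<open>I\<close> in probability.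
\<close>

definition is_ito_integral ::
    "'a measure \<Rightarrow> (real \<Rightarrow> 'a measure) \<Rightarrow> (real \<Rightarrow> 'a \<Rightarrow> real) \<Rightarrow> (real \<Rightarrow> 'a \<Rightarrow> real) \<Rightarrow> real \<Rightarrow>
     ('a \<Rightarrow> real) \<Rightarrow> bool" where
  "is_ito_integral M F W H t I \<longleftrightarrow>
     (AE \<omega> in M. set_integrable lborel {0..t} (\<lambda>s. (H s \<omega>)\<^sup>2)) \<and>
     (\<exists>S. (\<forall>n. simple_process F t (S n)) \<and>
          tendsto_in_prob M (\<lambda>n \<omega>. LINT s:{0..t}|lborel. (simple_value (S n) s \<omega> - H s \<omega>)\<^sup>2) (\<lambda>_. 0) \<and>
          tendsto_in_prob M (\<lambda>n. simple_integral W (S n)) I)"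

definition ito_solution ::
    "'a measure \<Rightarrow> (real \<Rightarrow> 'a measure) \<Rightarrow> (real \<Rightarrow> 'a \<Rightarrow> real) \<Rightarrow> (real \<Rightarrow> real) \<Rightarrow> (real \<Rightarrow> real) \<Rightarrow>
     real \<Rightarrow> real \<Rightarrow> (real \<Rightarrow> 'a \<Rightarrow> real) \<Rightarrow> bool" where
  "ito_solution M F W \<alpha> \<beta> u\<^sub>0 T u \<longleftrightarrow>
     (\<forall>t\<in>{0..T}. u t \<in> borel_measurable (F t)) \<and>
     (\<forall>\<omega>\<in>space M. continuous_on {0..T} (\<lambda>t. u t \<omega>)) \<and>
     (AE \<omega> in M. u 0 \<omega> = u\<^sub>0) \<and>
     (\<forall>t\<in>{0..T}. is_ito_integral M F W (\<lambda>s \<omega>. \<beta> (u s \<omega>)) t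
        (\<lambda>\<omega>. u t \<omega> - u\<^sub>0 - (LINT s:{0..t}|lborel. \<alpha> (u s \<omega>))))"

text \<open>Uniqueness of solutions is up to indistinguishability on \<open>[0, T]\<close>.\<close>

definition unique_ito_solution ::
    "'a measure \<Rightarrow> (real \<Rightarrow> 'a measure) \<Rightarrow> (real \<Rightarrow> 'a \<Rightarrow> real) \<Rightarrow> (real \<Rightarrow> real) \<Rightarrow> (real \<Rightarrow> real) \<Rightarrow>
     real \<Rightarrow> real \<Rightarrow> (real \<Rightarrow> 'a \<Rightarrow> real) \<Rightarrow> bool" where
  "unique_ito_solution M F W \<alpha> \<beta> u\<^sub>0 T u \<longleftrightarrow>
     ito_solution M F W \<alpha> \<beta> u\<^sub>0 T u \<and>
     (\<forall>v. ito_solution M F W \<alpha> \<beta> u\<^sub>0 T v \<longrightarrow> (AE \<omega> in M. \<forall>t\<in>{0..T}. v t \<omega> = u t \<omega>))"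

end

theory Submission
  imports Defs
begin

text \<open>
  The generator acts on elementary differentials by grafting. The factors of the elementary
  differential of \<open>\<tau>\<close> are indexed by its vertices, so by the product rule every derivative attaches
  one new edge to a vertex, in all possible ways. Hence \<open>\<alpha> \<partial>\<close> attaches one \<open>\<alpha>\<close>-leaf, and
  \<open>\<beta>\<^sup>2/2 \<partial>\<^sup>2\<close> attaches, with weight \<open>1/2\<close>, two \<open>\<beta>\<close>-leaves that form a pair; writing \<open>r\<close> for the
  number of new leaves, both cases are one formula, with weight \<open>1/r!\<close>
  (\<open>generator_elementary_differential\<close>).

  Removing leaves inverts grafting, but on isomorphism classes the two are counted with different
  multiplicities. They are compared by counting twice the isomorphisms from a grafted \<open>\<tau>'\<close> onto
  \<open>\<tau>\<close>: each one is given by an attachment and an isomorphism onto \<open>\<tau>\<close>, and also by a removable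
  block of \<open>\<tau>\<close>, a bijection of the new vertices onto that block, and an isomorphism of \<open>\<tau>'\<close> onto
  what remains. Therefore
  \<open>#{attachments to \<tau>' yielding \<tau>} \<sigma>(\<tau>) = r! m(\<tau>', \<tau>) \<sigma>(\<tau>')\<close> (\<open>attach_removal_balance\<close>).
  The factor \<open>r!\<close> cancels the weight above, and the recursion for the tree factorial is precisely
  what makes \<open>k! |\<tau>| / (\<sigma>(\<tau>) \<tau>!)\<close> the coefficient of \<open>\<tau>\<close> in \<open>L\<^sup>k f\<close>, by induction on \<open>k\<close>
  (\<open>generator_power\<close>). Dividing by \<open>k!\<close> gives the coefficients of the power series. In each degree
  the sum over trees is finite, because \<open>1/\<tau>!\<close> vanishes unless \<open>\<tau>\<close> arises from the single root by
  successive graftings (\<open>in_grown\<close>).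
\<close>

section \<open>Grafting a block of leaves\<close>

text \<open>
  The number of vertices that one term of the generator attaches: it is also the order of the
  derivative that this term contains.
\<close>

fun arity :: "colour \<Rightarrow> nat" where
  "arity Alpha = 1"
| "arity Beta = 2"

text \<open>
  Treating a single \<open>\<alpha>\<close>-leaf and a pair of \<open>\<beta>\<close>-leaves alike, as a block \<open>X\<close> of new vertices with
  a map \<open>g\<close> to their parents, spares the counting below a distinction by colour.
\<close>

definition graft :: "colour \<Rightarrow> nat set \<Rightarrow> (nat \<Rightarrow> nat) \<Rightarrow> pre_tree \<Rightarrow> pre_tree" where
  "graft c X g \<tau> = \<lparr>verts = verts \<tau> \<union> X, troot = troot \<tau>,
     parent = (\<lambda>v. if v \<in> X then g v else parent \<tau> v),
     vcolour = (\<lambda>v. if v \<in> X then c else vcolour \<tau> v),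
     pairing = pairing \<tau> \<union> (if c = Beta then {X} else {})\<rparr>"

lemma graft_sel [simp]:
  "verts (graft c X g \<tau>) = verts \<tau> \<union> X"
  "troot (graft c X g \<tau>) = troot \<tau>"
  "parent (graft c X g \<tau>) v = (if v \<in> X then g v else parent \<tau> v)"
  "vcolour (graft c X g \<tau>) v = (if v \<in> X then c else vcolour \<tau> v)"
  "pairing (graft c X g \<tau>) = pairing \<tau> \<union> (if c = Beta then {X} else {})"
  by (simp_all add: graft_def)

lemma remove_verts_sel [simp]:
  "verts (remove_verts \<tau> X) = verts \<tau> - X"
  "troot (remove_verts \<tau> X) = troot \<tau>"
  "parent (remove_verts \<tau> X) = parent \<tau>"
  "vcolour (remove_verts \<tau> X) = vcolour \<tau>"
  "pairing (remove_verts \<tau> X) = {p \<in> pairing \<tau>. p \<inter> X = {}}"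
  by (simp_all add: remove_verts_def)

definition removable_blocks :: "colour \<Rightarrow> pre_tree \<Rightarrow> nat set set" where
  "removable_blocks c \<tau> = {B. B \<subseteq> coloured_verts c \<tau> \<and> (\<forall>v\<in>B. is_leaf \<tau> v) \<and>
     card B = arity c \<and> (c = Beta \<longrightarrow> B \<in> pairing \<tau>)}"

lemma removable_blocks_Alpha: "removable_blocks Alpha \<tau> = (\<lambda>v. {v}) ` alpha_leaves \<tau>"
  by (auto simp: removable_blocks_def alpha_leaves_def card_1_singleton_iff)

lemma removable_blocks_Beta:
  assumes "exotic_wf \<tau>"
  shows "removable_blocks Beta \<tau> = beta_leaf_pairs \<tau>"
  using assms pairing_subset(1)[OF assms]
  by (auto simp: removable_blocks_def beta_leaf_pairs_def exotic_wf_def)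

lemma wf_remove_block:
  assumes "exotic_wf \<tau>" "B \<in> removable_blocks c \<tau>"
  shows "exotic_wf (remove_verts \<tau> B)"
  using assms by (intro wf_remove)
    (cases c; auto simp: removable_blocks_def coloured_verts_def)+

lemma finite_removable_blocks:
  assumes "exotic_wf \<tau>"
  shows "finite (removable_blocks c \<tau>)"
  using assms by (cases c)
    (simp_all add: removable_blocks_Alpha removable_blocks_Beta finite_alpha_leaves
      finite_beta_leaf_pairs)

locale grafting =
  fixes \<tau> :: pre_tree and c :: colour and X :: "nat set"
  assumes wf: "exotic_wf \<tau>" and fresh: "X \<inter> verts \<tau> = {}" and card_X: "card X = arity c"
begin

lemma finite_X: "finite X"
  using card_X by (cases c) (auto intro: card_ge_0_finite)

lemma root: "troot \<tau> \<in> verts \<tau>" "troot \<tau> \<notin> X"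
  using wf fresh by (auto simp: exotic_wf_def)

lemma inner_graft: "inner_verts (graft c X g \<tau>) = inner_verts \<tau> \<union> X"
  using root by (auto simp: inner_verts_def)

lemma inner_fresh: "v \<in> inner_verts \<tau> \<Longrightarrow> v \<notin> X"
  using fresh by (auto simp: inner_verts_def)

lemma parent_in: "v \<in> inner_verts \<tau> \<Longrightarrow> parent \<tau> v \<in> verts \<tau>"
  using wf by (auto simp: exotic_wf_def)

lemma coloured_graft:
  "coloured_verts d (graft c X g \<tau>) = coloured_verts d \<tau> \<union> (if d = c then X else {})"
  using inner_fresh by (auto simp: coloured_verts_def inner_graft)

lemma children_graft:
  assumes "v \<in> verts \<tau>"
  shows "children (graft c X g \<tau>) v = children \<tau> v \<union> {x \<in> X. g x = v}"
  using inner_fresh by (auto simp: children_def inner_graft)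

lemma children_graft_new:
  assumes "g \<in> X \<rightarrow> verts \<tau>" "x \<in> X"
  shows "children (graft c X g \<tau>) x = {}"
  using assms fresh parent_in inner_fresh by (auto simp: children_def inner_graft)

lemma wf_graft:
  assumes g: "g \<in> X \<rightarrow> verts \<tau>"
  shows "exotic_wf (graft c X g \<tau>)"
proof -
  let ?\<tau> = "graft c X g \<tau>"
  \<comment> \<open>The parent of the root is arbitrary and may lie in \<open>X\<close>, so the number of steps need not
    agree with that in \<open>\<tau>\<close>: the walk is stopped at the first visit to the root.\<close>
  have old: "\<exists>k. (parent ?\<tau> ^^ k) v = troot \<tau>"
    if "v \<in> verts \<tau>" "(parent \<tau> ^^ k) v = troot \<tau>" for v k
    using that
  proof (induction k arbitrary: v)
    case 0
    then show ?case by (auto intro: exI[of _ 0])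
  next
    case (Suc k)
    show ?case
    proof (cases "v = troot \<tau>")
      case True
      then show ?thesis by (auto intro: exI[of _ 0])
    next
      case False
      then have v: "v \<in> inner_verts \<tau>" using Suc.prems by (simp add: inner_verts_def)
      have "(parent \<tau> ^^ k) (parent \<tau> v) = troot \<tau>"
        using Suc.prems(2) by (simp add: funpow_swap1)
      from Suc.IH[OF parent_in[OF v] this] obtain k'
        where "(parent ?\<tau> ^^ k') (parent \<tau> v) = troot \<tau>" ..
      then have "(parent ?\<tau> ^^ Suc k') v = troot \<tau>"
        using inner_fresh[OF v] by (simp only: funpow_Suc_right o_def graft_sel if_False)
      then show ?thesis ..
    qed
  qed
  have reach: "\<exists>k. (parent ?\<tau> ^^ k) v = troot \<tau>" if v: "v \<in> verts \<tau>" for v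
    using old[OF v] wf v by (auto simp: exotic_wf_def)
  have new: "\<exists>k. (parent ?\<tau> ^^ k) x = troot \<tau>" if x: "x \<in> X" for x
  proof -
    obtain k where "(parent ?\<tau> ^^ k) (g x) = troot \<tau>" using reach[of "g x"] g x by auto
    then have "(parent ?\<tau> ^^ Suc k) x = troot \<tau>"
      using x by (simp only: funpow_Suc_right o_def graft_sel if_True)
    then show ?thesis ..
  qed
  have part: "partition_on (coloured_verts Beta \<tau>) (pairing \<tau>)"
    using wf by (simp add: exotic_wf_def)
  have "partition_on (coloured_verts Beta ?\<tau>) (pairing ?\<tau>)"
  proof (cases c)
    case Alpha
    then show ?thesis using part coloured_graft[of Beta g] by simp
  next
    case Beta
    have "X \<noteq> {}" using card_X Beta by auto
    moreover have "coloured_verts Beta \<tau> \<inter> X = {}"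
      using inner_fresh by (auto simp: coloured_verts_def)
    ultimately have "partition_on (X \<union> coloured_verts Beta \<tau>) (insert X (pairing \<tau>))"
      using part by (auto simp: partition_on_def disjoint_def)
    then show ?thesis using Beta coloured_graft[of Beta g] by (simp add: Un_commute)
  qed
  moreover have "\<forall>p\<in>pairing ?\<tau>. card p = 2"
    using wf card_X by (auto simp: exotic_wf_def)
  ultimately show ?thesis
    using wf g finite_X reach new parent_in root
    unfolding exotic_wf_def inner_graft by (auto simp: inner_fresh)
qed

text \<open>
  An isomorphism carries the new block, whose vertices are leaves, onto a removable block of the
  target. Deleting both blocks leaves an isomorphism of \<open>\<tau>\<close>; conversely such an isomorphism
  extends over \<open>X\<close> as soon as \<open>g\<close> names the right parents.
\<close>

lemma iso_graft_iff:
  assumes g: "g \<in> X \<rightarrow> verts \<tau>" and wf': "exotic_wf \<tau>'"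
  shows "exotic_iso \<psi> (graft c X g \<tau>) \<tau>' \<longleftrightarrow>
    inj_on \<psi> X \<and> \<psi> ` X \<in> removable_blocks c \<tau>' \<and>
    exotic_iso \<psi> \<tau> (remove_verts \<tau>' (\<psi> ` X)) \<and> (\<forall>x\<in>X. \<psi> (g x) = parent \<tau>' (\<psi> x))"
    (is "?L \<longleftrightarrow> ?R")
proof
  let ?\<tau> = "graft c X g \<tau>"
  note wfg = wf_graft[OF g]
  assume L: ?L
  have inj: "inj_on \<psi> (verts \<tau> \<union> X)" using L by (simp add: exotic_iso_def bij_betw_def)
  have injX: "inj_on \<psi> X" using inj by (rule inj_on_subset) simp
  have Xc: "X \<subseteq> coloured_verts c ?\<tau>" by (simp add: coloured_graft)
  have Xi: "X \<subseteq> inner_verts ?\<tau>" by (simp add: inner_graft)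
  have block: "\<psi> ` X \<in> removable_blocks c \<tau>'"
    unfolding removable_blocks_def
  proof (intro CollectI conjI impI)
    show "\<psi> ` X \<subseteq> coloured_verts c \<tau>'"
      using iso_coloured[OF L wfg, of c] Xc by (auto simp: bij_betw_def)
    show "\<forall>v\<in>\<psi> ` X. is_leaf \<tau>' v"
    proof (intro ballI, elim imageE)
      fix v x assume x: "v = \<psi> x" "x \<in> X"
      then have "is_leaf ?\<tau> x"
        using Xi children_graft_new[OF g x(2)] by (auto simp: is_leaf_def)
      then show "is_leaf \<tau>' v" using iso_leaf[OF L wfg, of x] Xi x by auto
    qed
    show "card (\<psi> ` X) = arity c" using card_image[OF injX] card_X by simp
    show "\<psi> ` X \<in> pairing \<tau>'" if "c = Beta"
      using L that by (auto simp: exotic_iso_def)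
  qed
  have rem: "exotic_iso \<psi> (remove_verts ?\<tau> X) (remove_verts \<tau>' (\<psi> ` X))"
    by (rule iso_remove[OF L wfg Xi])
  have pX: "p \<inter> X = {}" if "p \<in> pairing \<tau>" for p
    using pairing_subset(3)[OF wf that] fresh by blast
  have "pairing (remove_verts ?\<tau> X) = pairing \<tau>"
    using pX card_X by (auto split: if_splits)
  moreover have "verts (remove_verts ?\<tau> X) = verts \<tau>"
    using fresh by auto
  moreover have "inner_verts (remove_verts ?\<tau> X) = inner_verts \<tau>"
    using fresh by (auto simp: inner_verts_def)
  ultimately have iso: "exotic_iso \<psi> \<tau> (remove_verts \<tau>' (\<psi> ` X))"
    using rem inner_fresh unfolding exotic_iso_def by auto
  have "\<psi> (g x) = parent \<tau>' (\<psi> x)" if x: "x \<in> X" for x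
  proof -
    have "\<psi> (parent ?\<tau> x) = parent \<tau>' (\<psi> x)" using L Xi x unfolding exotic_iso_def by blast
    then show ?thesis using x by simp
  qed
  with injX block iso show ?R by blast
next
  let ?\<tau> = "graft c X g \<tau>" and ?\<rho> = "remove_verts \<tau>' (\<psi> ` X)"
  assume R: ?R
  then have injX: "inj_on \<psi> X" and block: "\<psi> ` X \<in> removable_blocks c \<tau>'"
    and iso: "exotic_iso \<psi> \<tau> ?\<rho>" and par: "\<And>x. x \<in> X \<Longrightarrow> \<psi> (g x) = parent \<tau>' (\<psi> x)"
    by auto
  have cX: "\<psi> ` X \<subseteq> coloured_verts c \<tau>'" using block by (simp add: removable_blocks_def)
  then have X': "\<psi> ` X \<subseteq> verts \<tau>'" by (auto simp: coloured_verts_def inner_verts_def)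
  have bij: "bij_betw \<psi> (verts \<tau>) (verts \<tau>' - \<psi> ` X)" using iso by (simp add: exotic_iso_def)
  have "bij_betw \<psi> (verts \<tau> \<union> X) ((verts \<tau>' - \<psi> ` X) \<union> \<psi> ` X)"
    using bij injX by (intro bij_betw_combine) (auto simp: bij_betw_def)
  moreover have "(verts \<tau>' - \<psi> ` X) \<union> \<psi> ` X = verts \<tau>'" using X' by blast
  ultimately have b: "bij_betw \<psi> (verts \<tau> \<union> X) (verts \<tau>')" by simp
  have pair: "(\<lambda>p. \<psi> ` p) ` pairing ?\<tau> = pairing \<tau>'"
  proof (cases c)
    case Alpha
    have "p \<inter> \<psi> ` X = {}" if "p \<in> pairing \<tau>'" for p
    proof -
      have "coloured_verts Alpha \<tau>' \<inter> coloured_verts Beta \<tau>' = {}"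
        by (auto simp: coloured_verts_def)
      then show ?thesis using pairing_subset(1)[OF wf' that] cX Alpha by blast
    qed
    then have "pairing ?\<rho> = pairing \<tau>'" by auto
    then show ?thesis using iso Alpha by (simp add: exotic_iso_def)
  next
    case Beta
    have B: "\<psi> ` X \<in> pairing \<tau>'" using block Beta by (simp add: removable_blocks_def)
    have "\<And>p q. p \<in> pairing \<tau>' \<Longrightarrow> q \<in> pairing \<tau>' \<Longrightarrow> p \<noteq> q \<Longrightarrow> p \<inter> q = {}"
      using wf' by (auto simp: exotic_wf_def partition_on_def disjoint_def)
    moreover have "\<psi> ` X \<noteq> {}" using card_X Beta by auto
    ultimately have "insert (\<psi> ` X) (pairing ?\<rho>) = pairing \<tau>'" using B by auto
    then show ?thesis using iso Beta by (simp add: exotic_iso_def)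
  qed
  have root': "\<psi> (troot \<tau>) = troot \<tau>'" using iso by (simp add: exotic_iso_def)
  have inn: "\<psi> (parent ?\<tau> v) = parent \<tau>' (\<psi> v) \<and> vcolour \<tau>' (\<psi> v) = vcolour ?\<tau> v"
    if v: "v \<in> inner_verts ?\<tau>" for v
  proof (cases "v \<in> X")
    case True
    then show ?thesis using par cX by (auto simp: coloured_verts_def)
  next
    case False
    then have "v \<in> inner_verts \<tau>" using v by (simp add: inner_graft)
    then show ?thesis using iso False by (simp add: exotic_iso_def)
  qed
  show ?L
    unfolding exotic_iso_def using b root' inn pair by simp
qed

end

section \<open>Counting isomorphisms in two ways\<close>

text \<open>
  Isomorphisms are normalised outside the vertex set, so that each is counted once. Here they
  are \<open>undefined\<close> there, which allows restricting and gluing them; automorphisms are the identity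
  there, as in the definition of the symmetry factor.
\<close>

definition tree_isos :: "pre_tree \<Rightarrow> pre_tree \<Rightarrow> (nat \<Rightarrow> nat) set" where
  "tree_isos \<tau> \<tau>' = {\<phi> \<in> extensional (verts \<tau>). exotic_iso \<phi> \<tau> \<tau>'}"

definition tree_autos :: "pre_tree \<Rightarrow> (nat \<Rightarrow> nat) set" where
  "tree_autos \<tau> = {\<phi>. \<phi> permutes verts \<tau> \<and> exotic_iso \<phi> \<tau> \<tau>}"

lemma tree_autos_cong: "exotic_equiv \<tau> \<tau>' \<Longrightarrow> card (tree_autos \<tau>) = card (tree_autos \<tau>')"
  unfolding tree_autos_def by (intro order_antisym auto_count_le) (auto intro: exotic_equiv_sym)

lemma card_bijections:
  assumes "finite A" "finite B" "card A = card B"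
  shows "card {f \<in> extensional A. inj_on f A \<and> f ` A = B} = fact (card A)"
proof -
  obtain e where e: "bij_betw e A B" using finite_same_card_bij[OF assms] by blast
  let ?i = "inv_into A e"
  have [simp]: "?i (e x) = x" "e x \<in> B" if "x \<in> A" for x
    using e that by (auto simp: bij_betw_def)
  have [simp]: "e (?i y) = y" "?i y \<in> A" if "y \<in> B" for y
    using e that by (auto simp: bij_betw_def f_inv_into_f inv_into_into)
  have "bij_betw (\<lambda>p. restrict (e \<circ> p) A) {p. p permutes A}
      {f \<in> extensional A. inj_on f A \<and> f ` A = B}"
  proof (rule bij_betw_byWitness[where f' = "\<lambda>f x. if x \<in> A then ?i (f x) else x"])
    show "\<forall>p\<in>{p. p permutes A}. (\<lambda>x. if x \<in> A then ?i (restrict (e \<circ> p) A x) else x) = p"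
      by (auto simp: fun_eq_iff permutes_not_in permutes_in_image)
    show "\<forall>f\<in>{f \<in> extensional A. inj_on f A \<and> f ` A = B}.
        restrict (e \<circ> (\<lambda>x. if x \<in> A then ?i (f x) else x)) A = f"
      by (auto simp: fun_eq_iff extensional_def)
    have "bij_betw (restrict (e \<circ> p) A) A B" if "p permutes A" for p
    proof -
      have "bij_betw (e \<circ> p) A B" using bij_betw_trans[OF permutes_imp_bij[OF that] e] .
      then show ?thesis by (subst bij_betw_cong[of _ _ "e \<circ> p"]) auto
    qed
    then show "(\<lambda>p. restrict (e \<circ> p) A) ` {p. p permutes A}
        \<subseteq> {f \<in> extensional A. inj_on f A \<and> f ` A = B}"
      unfolding bij_betw_def by blast
    have "(\<lambda>x. if x \<in> A then ?i (f x) else x) permutes A" if "inj_on f A" "f ` A = B" for f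
    proof (rule bij_imp_permutes)
      have "bij_betw (?i \<circ> f) A A"
        using that bij_betw_trans[OF _ bij_betw_inv_into[OF e]] by (auto simp: bij_betw_def)
      then show "bij_betw (\<lambda>x. if x \<in> A then ?i (f x) else x) A A"
        by (subst bij_betw_cong[of _ _ "?i \<circ> f"]) auto
    qed simp
    then show "(\<lambda>f x. if x \<in> A then ?i (f x) else x) `
        {f \<in> extensional A. inj_on f A \<and> f ` A = B} \<subseteq> {p. p permutes A}"
      by auto
  qed
  then show ?thesis
    using bij_betw_same_card card_permutations[OF refl assms(1)] by fastforce
qed

text \<open>The isomorphisms onto \<open>\<tau>'\<close> form a torsor under its automorphism group.\<close>

lemma card_tree_isos:
  assumes eq: "exotic_equiv \<tau> \<tau>'"
  shows "card (tree_isos \<tau> \<tau>') = card (tree_autos \<tau>')"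
proof -
  obtain \<phi> where \<phi>: "exotic_iso \<phi> \<tau> \<tau>'" and wf: "exotic_wf \<tau>" "exotic_wf \<tau>'"
    using eq by (rule exotic_equivE)
  let ?i = "inv_into (verts \<tau>) \<phi>"
  have i: "exotic_iso ?i \<tau>' \<tau>" by (rule exotic_iso_sym[OF \<phi> wf(1)])
  have b: "bij_betw \<phi> (verts \<tau>) (verts \<tau>')" using \<phi> by (simp add: exotic_iso_def)
  have [simp]: "?i (\<phi> v) = v" "\<phi> v \<in> verts \<tau>'" if "v \<in> verts \<tau>" for v
    using b that by (auto simp: bij_betw_def)
  have [simp]: "\<phi> (?i v) = v" "?i v \<in> verts \<tau>" if "v \<in> verts \<tau>'" for v
    using b that by (auto simp: bij_betw_def f_inv_into_f inv_into_into)
  have "bij_betw (\<lambda>\<psi>. restrict (\<psi> \<circ> \<phi>) (verts \<tau>)) (tree_autos \<tau>') (tree_isos \<tau> \<tau>')"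
  proof (rule bij_betw_byWitness[where f' = "\<lambda>\<theta> v. if v \<in> verts \<tau>' then \<theta> (?i v) else v"])
    show "\<forall>\<psi>\<in>tree_autos \<tau>'.
        (\<lambda>v. if v \<in> verts \<tau>' then restrict (\<psi> \<circ> \<phi>) (verts \<tau>) (?i v) else v) = \<psi>"
      by (auto simp: tree_autos_def fun_eq_iff permutes_not_in)
    show "\<forall>\<theta>\<in>tree_isos \<tau> \<tau>'. restrict
        ((\<lambda>v. if v \<in> verts \<tau>' then \<theta> (?i v) else v) \<circ> \<phi>) (verts \<tau>) = \<theta>"
      by (auto simp: tree_isos_def fun_eq_iff extensional_def)
    show "(\<lambda>\<psi>. restrict (\<psi> \<circ> \<phi>) (verts \<tau>)) ` tree_autos \<tau>' \<subseteq> tree_isos \<tau> \<tau>'"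
      using exotic_iso_cong[OF exotic_iso_trans[OF \<phi> _ wf(1)] wf(1)]
      by (auto simp: tree_autos_def tree_isos_def)
    show "(\<lambda>\<theta> v. if v \<in> verts \<tau>' then \<theta> (?i v) else v) ` tree_isos \<tau> \<tau>' \<subseteq> tree_autos \<tau>'"
    proof (rule image_subsetI)
      fix \<theta> assume "\<theta> \<in> tree_isos \<tau> \<tau>'"
      then have "exotic_iso (\<theta> \<circ> ?i) \<tau>' \<tau>'"
        using exotic_iso_trans[OF i _ wf(2)] by (simp add: tree_isos_def)
      then have iso: "exotic_iso (\<lambda>v. if v \<in> verts \<tau>' then \<theta> (?i v) else v) \<tau>' \<tau>'"
        by (rule exotic_iso_cong[OF _ wf(2)]) simp
      then have "(\<lambda>v. if v \<in> verts \<tau>' then \<theta> (?i v) else v) permutes verts \<tau>'"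
        by (intro bij_imp_permutes) (simp_all add: exotic_iso_def)
      then show "(\<lambda>v. if v \<in> verts \<tau>' then \<theta> (?i v) else v) \<in> tree_autos \<tau>'"
        using iso by (simp add: tree_autos_def)
    qed
  qed
  then show ?thesis by (rule bij_betw_same_card[symmetric])
qed

lemma tree_isos_nonempty_iff:
  assumes "exotic_wf \<tau>" "exotic_wf \<tau>'"
  shows "tree_isos \<tau> \<tau>' \<noteq> {} \<longleftrightarrow> exotic_equiv \<tau> \<tau>'"
proof
  assume "exotic_equiv \<tau> \<tau>'"
  then obtain \<phi> where "exotic_iso \<phi> \<tau> \<tau>'" by (rule exotic_equivE)
  then have "restrict \<phi> (verts \<tau>) \<in> tree_isos \<tau> \<tau>'"
    using exotic_iso_cong[OF _ assms(1)] by (simp add: tree_isos_def)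
  then show "tree_isos \<tau> \<tau>' \<noteq> {}" by blast
qed (use assms in \<open>auto simp: tree_isos_def exotic_equiv_def\<close>)

lemma finite_tree_isos:
  assumes "exotic_wf \<tau>" "exotic_wf \<tau>'"
  shows "finite (tree_isos \<tau> \<tau>')"
proof -
  have "tree_isos \<tau> \<tau>' \<subseteq> verts \<tau> \<rightarrow>\<^sub>E verts \<tau>'"
    by (auto simp: tree_isos_def exotic_iso_def bij_betw_def PiE_def)
  then show ?thesis
    by (rule finite_subset) (use assms in \<open>auto simp: exotic_wf_def intro: finite_PiE\<close>)
qed

lemma card_tree_isos_if:
  assumes "exotic_wf \<tau>" "exotic_wf \<tau>'"
  shows "card (tree_isos \<tau> \<tau>') = (if exotic_equiv \<tau> \<tau>' then card (tree_autos \<tau>') else 0)"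
  using card_tree_isos tree_isos_nonempty_iff[OF assms] by auto

lemma card_tree_autos_pos:
  assumes "exotic_wf \<tau>"
  shows "card (tree_autos \<tau>) > 0"
proof -
  have "id \<in> tree_autos \<tau>" by (simp add: tree_autos_def permutes_id exotic_iso_refl)
  moreover have "finite (tree_autos \<tau>)"
    using finite_permutations[of "verts \<tau>"] assms
    by (auto simp: tree_autos_def exotic_wf_def intro: rev_finite_subset)
  ultimately show ?thesis by (auto simp: card_gt_0_iff)
qed

context grafting begin

text \<open>
  The set counted twice. Its definition sorts the isomorphisms by the block on which \<open>X\<close> lands and
  does not mention the attachment, which is read off from the parents in the target.
\<close>

definition graft_isos :: "pre_tree \<Rightarrow> (nat \<Rightarrow> nat) set" where
  "graft_isos \<tau>' = {\<psi> \<in> extensional (verts \<tau> \<union> X). inj_on \<psi> X \<and>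
     \<psi> ` X \<in> removable_blocks c \<tau>' \<and> exotic_iso \<psi> \<tau> (remove_verts \<tau>' (\<psi> ` X))}"

lemma finite_verts: "finite (verts \<tau>)"
  using wf by (simp add: exotic_wf_def)

lemma graft_isos_eq_UN:
  assumes wf': "exotic_wf \<tau>'"
  shows "graft_isos \<tau>' = (\<Union>g\<in>X \<rightarrow>\<^sub>E verts \<tau>. tree_isos (graft c X g \<tau>) \<tau>')"
proof (intro equalityI subsetI)
  fix \<psi> assume \<psi>: "\<psi> \<in> graft_isos \<tau>'"
  then have iso: "exotic_iso \<psi> \<tau> (remove_verts \<tau>' (\<psi> ` X))"
    and block: "\<psi> ` X \<in> removable_blocks c \<tau>'"
    by (auto simp: graft_isos_def)
  have sur: "\<psi> ` verts \<tau> = verts \<tau>' - \<psi> ` X"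
    using iso by (simp add: exotic_iso_def bij_betw_def)
  have par: "parent \<tau>' (\<psi> x) \<in> \<psi> ` verts \<tau>" if "x \<in> X" for x
  proof -
    have inn: "\<psi> x \<in> inner_verts \<tau>'"
      using block that by (auto simp: removable_blocks_def is_leaf_def)
    then have "parent \<tau>' (\<psi> x) \<notin> \<psi> ` X"
      using block by (auto simp: removable_blocks_def is_leaf_def children_def)
    with inn show ?thesis
      using wf' by (auto simp: sur exotic_wf_def)
  qed
  \<comment> \<open>The parent of a removed leaf is not itself removed, so it comes from a vertex of \<open>\<tau>\<close>.\<close>
  define g where "g = (\<lambda>x\<in>X. inv_into (verts \<tau>) \<psi> (parent \<tau>' (\<psi> x)))"
  have g: "g \<in> X \<rightarrow>\<^sub>E verts \<tau>" "\<forall>x\<in>X. \<psi> (g x) = parent \<tau>' (\<psi> x)"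
    using par by (auto simp: g_def inv_into_into f_inv_into_f)
  then have "exotic_iso \<psi> (graft c X g \<tau>) \<tau>'"
    using \<psi> by (subst iso_graft_iff[OF _ wf']) (auto simp: graft_isos_def)
  then show "\<psi> \<in> (\<Union>g\<in>X \<rightarrow>\<^sub>E verts \<tau>. tree_isos (graft c X g \<tau>) \<tau>')"
    using g(1) \<psi> by (auto simp: tree_isos_def graft_isos_def)
next
  fix \<psi> assume "\<psi> \<in> (\<Union>g\<in>X \<rightarrow>\<^sub>E verts \<tau>. tree_isos (graft c X g \<tau>) \<tau>')"
  then obtain g where g: "g \<in> X \<rightarrow>\<^sub>E verts \<tau>" and \<psi>: "\<psi> \<in> tree_isos (graft c X g \<tau>) \<tau>'" by blast
  then have "g \<in> X \<rightarrow> verts \<tau>" by auto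
  from iso_graft_iff[OF this wf'] \<psi> show "\<psi> \<in> graft_isos \<tau>'"
    by (auto simp: tree_isos_def graft_isos_def)
qed

lemma card_graft_isos_by_grafts:
  assumes wf': "exotic_wf \<tau>'"
  shows "card (graft_isos \<tau>') =
    card {g \<in> X \<rightarrow>\<^sub>E verts \<tau>. exotic_equiv (graft c X g \<tau>) \<tau>'} * card (tree_autos \<tau>')"
proof -
  let ?G = "X \<rightarrow>\<^sub>E verts \<tau>"
  have Pi: "g \<in> X \<rightarrow> verts \<tau>" if "g \<in> ?G" for g using that by auto
  have finG: "finite ?G" using finite_X finite_verts by (intro finite_PiE) auto
  have "card (graft_isos \<tau>') = (\<Sum>g\<in>?G. card (tree_isos (graft c X g \<tau>) \<tau>'))"
    unfolding graft_isos_eq_UN[OF wf']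
  proof (rule card_UN_disjoint[OF finG]; intro ballI impI)
    show "finite (tree_isos (graft c X g \<tau>) \<tau>')" if "g \<in> ?G" for g
      by (rule finite_tree_isos[OF wf_graft[OF Pi[OF that]] wf'])
    fix g h assume gh: "g \<in> ?G" "h \<in> ?G" "g \<noteq> h"
    show "tree_isos (graft c X g \<tau>) \<tau>' \<inter> tree_isos (graft c X h \<tau>) \<tau>' = {}"
    proof (rule ccontr)
      assume "tree_isos (graft c X g \<tau>) \<tau>' \<inter> tree_isos (graft c X h \<tau>) \<tau>' \<noteq> {}"
      then obtain \<psi> where \<psi>: "exotic_iso \<psi> (graft c X g \<tau>) \<tau>'" "exotic_iso \<psi> (graft c X h \<tau>) \<tau>'"
        by (auto simp: tree_isos_def)
      have g: "\<forall>x\<in>X. \<psi> (g x) = parent \<tau>' (\<psi> x)"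
        and iso: "exotic_iso \<psi> \<tau> (remove_verts \<tau>' (\<psi> ` X))"
        using iffD1[OF iso_graft_iff[OF Pi[OF gh(1)] wf'] \<psi>(1)] by simp_all
      have h: "\<forall>x\<in>X. \<psi> (h x) = parent \<tau>' (\<psi> x)"
        using iffD1[OF iso_graft_iff[OF Pi[OF gh(2)] wf'] \<psi>(2)] by simp
      have eq: "\<forall>x\<in>X. \<psi> (g x) = \<psi> (h x)" using g h by simp
      have inj: "inj_on \<psi> (verts \<tau>)" using iso by (simp add: exotic_iso_def bij_betw_def)
      have "g x = h x" if "x \<in> X" for x
        using inj_onD[OF inj] eq that gh by (meson PiE_mem)
      then have "g = h" using gh by (intro PiE_ext[of g X _ h]) auto
      then show False using gh(3) by blast
    qed
  qed
  also have "\<dots> = (\<Sum>g\<in>?G. if exotic_equiv (graft c X g \<tau>) \<tau>' then card (tree_autos \<tau>') else 0)"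
    by (intro sum.cong refl card_tree_isos_if wf_graft wf') auto
  also have "\<dots> = card {g \<in> ?G. exotic_equiv (graft c X g \<tau>) \<tau>'} * card (tree_autos \<tau>')"
    using finG by (simp add: sum.If_cases Int_def)
  finally show ?thesis .
qed

text \<open>
  Such a map consists of two independent parts: a bijection of \<open>X\<close> onto \<open>B\<close> and an isomorphism of
  \<open>\<tau>\<close> onto the tree without \<open>B\<close>.
\<close>

lemma card_graft_isos_onto:
  assumes wf': "exotic_wf \<tau>'" and B: "B \<in> removable_blocks c \<tau>'"
  shows "card {\<psi> \<in> graft_isos \<tau>'. \<psi> ` X = B} =
    fact (arity c) * card (tree_isos \<tau> (remove_verts \<tau>' B))"
proof -
  let ?E = "{e \<in> extensional X. inj_on e X \<and> e ` X = B}"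
  let ?I = "tree_isos \<tau> (remove_verts \<tau>' B)"
  let ?glue = "\<lambda>(e, \<phi>) v. if v \<in> X then e v else \<phi> v"
  have finB: "finite B"
    using B finite_coloured[OF wf'] by (auto simp: removable_blocks_def intro: finite_subset)
  have nX: "v \<notin> X" if "v \<in> verts \<tau>" for v using that fresh by blast
  have "bij_betw ?glue (?E \<times> ?I) {\<psi> \<in> graft_isos \<tau>'. \<psi> ` X = B}"
  proof (rule bij_betw_byWitness[where f' = "\<lambda>\<psi>. (restrict \<psi> X, restrict \<psi> (verts \<tau>))"])
    show "\<forall>p\<in>?E \<times> ?I. (restrict (?glue p) X, restrict (?glue p) (verts \<tau>)) = p"
      by (auto simp: tree_isos_def extensional_def fun_eq_iff nX)
    show "\<forall>\<psi>\<in>{\<psi> \<in> graft_isos \<tau>'. \<psi> ` X = B}. ?glue (restrict \<psi> X, restrict \<psi> (verts \<tau>)) = \<psi>"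
      by (auto simp: graft_isos_def extensional_def fun_eq_iff)
    show "(\<lambda>\<psi>. (restrict \<psi> X, restrict \<psi> (verts \<tau>))) ` {\<psi> \<in> graft_isos \<tau>'. \<psi> ` X = B} \<subseteq> ?E \<times> ?I"
      using exotic_iso_cong[OF _ wf]
      by (auto simp: graft_isos_def tree_isos_def inj_on_restrict_eq)
    show "?glue ` (?E \<times> ?I) \<subseteq> {\<psi> \<in> graft_isos \<tau>'. \<psi> ` X = B}"
    proof (rule image_subsetI)
      fix p assume p: "p \<in> ?E \<times> ?I"
      then obtain e \<phi> where e: "p = (e, \<phi>)" "e \<in> ?E" "\<phi> \<in> ?I" by blast
      have im: "?glue p ` X = B" using e by auto
      have inj: "inj_on (?glue p) X" using e by (auto simp: inj_on_def)
      have "exotic_iso (?glue p) \<tau> (remove_verts \<tau>' B)"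
        by (rule exotic_iso_cong[OF _ wf, of \<phi>]) (use e nX in \<open>auto simp: tree_isos_def\<close>)
      moreover have "?glue p \<in> extensional (verts \<tau> \<union> X)"
        using e by (auto simp: tree_isos_def extensional_def)
      ultimately show "?glue p \<in> {\<psi> \<in> graft_isos \<tau>'. \<psi> ` X = B}"
        using im inj B unfolding graft_isos_def by simp
    qed
  qed
  then have "card {\<psi> \<in> graft_isos \<tau>'. \<psi> ` X = B} = card ?E * card ?I"
    by (simp add: bij_betw_same_card[symmetric] card_cartesian_product)
  also have "card ?E = fact (arity c)"
    using finB B card_X card_bijections[OF finite_X, of B] by (simp add: removable_blocks_def)
  finally show ?thesis by simp
qed

lemma card_graft_isos_by_blocks:
  assumes wf': "exotic_wf \<tau>'"
  shows "card (graft_isos \<tau>') = fact (arity c) *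
    card {B \<in> removable_blocks c \<tau>'. exotic_equiv (remove_verts \<tau>' B) \<tau>} * card (tree_autos \<tau>)"
proof -
  let ?R = "removable_blocks c \<tau>'"
  have finR: "finite ?R" by (rule finite_removable_blocks[OF wf'])
  have iso: "card (tree_isos \<tau> (remove_verts \<tau>' B)) =
      (if exotic_equiv (remove_verts \<tau>' B) \<tau> then card (tree_autos \<tau>) else 0)" if "B \<in> ?R" for B
    using card_tree_isos_if[OF wf wf_remove_block[OF wf' that]] tree_autos_cong exotic_equiv_sym
    by metis
  have fin: "finite (graft_isos \<tau>')"
    unfolding graft_isos_eq_UN[OF wf'] using finite_X finite_verts
    by (auto intro!: finite_UN_I finite_PiE finite_tree_isos wf_graft wf')
  have "graft_isos \<tau>' = (\<Union>B\<in>?R. {\<psi> \<in> graft_isos \<tau>'. \<psi> ` X = B})"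
    by (auto simp: graft_isos_def)
  then have "card (graft_isos \<tau>') = card (\<Union>B\<in>?R. {\<psi> \<in> graft_isos \<tau>'. \<psi> ` X = B})" by simp
  also have "\<dots> = (\<Sum>B\<in>?R. card {\<psi> \<in> graft_isos \<tau>'. \<psi> ` X = B})"
    by (rule card_UN_disjoint[OF finR]) (use fin in auto)
  also have "\<dots> = (\<Sum>B\<in>?R. if exotic_equiv (remove_verts \<tau>' B) \<tau>
      then fact (arity c) * card (tree_autos \<tau>) else 0)"
    using iso by (intro sum.cong) (auto simp: card_graft_isos_onto[OF wf'])
  also have "\<dots> = card {B \<in> ?R. exotic_equiv (remove_verts \<tau>' B) \<tau>} *
      (fact (arity c) * card (tree_autos \<tau>))"
    using finR by (simp add: sum.If_cases Int_def)
  finally show ?thesis by (simp add: ac_simps)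
qed

lemma graft_removal_balance:
  assumes "exotic_wf \<tau>'"
  shows "card {g \<in> X \<rightarrow>\<^sub>E verts \<tau>. exotic_equiv (graft c X g \<tau>) \<tau>'} * card (tree_autos \<tau>') =
    fact (arity c) * card {B \<in> removable_blocks c \<tau>'. exotic_equiv (remove_verts \<tau>' B) \<tau>} *
    card (tree_autos \<tau>)"
  using card_graft_isos_by_grafts[OF assms] card_graft_isos_by_blocks[OF assms] by simp

end

section \<open>Higher derivatives of products\<close>

lemma smooth_has_deriv:
  assumes "smooth F"
  shows "((deriv ^^ n) F has_real_derivative (deriv ^^ Suc n) F x) (at x)"
  using assms by (simp add: smooth_def DERIV_deriv_iff_real_differentiable)

lemma sum_PiE_insert:
  assumes "n \<notin> X" "finite X" "finite V"
  shows "(\<Sum>g\<in>insert n X \<rightarrow>\<^sub>E V. h g) = (\<Sum>g\<in>X \<rightarrow>\<^sub>E V. \<Sum>w\<in>V. h (g(n := w)))"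
proof -
  have "(\<Sum>g\<in>insert n X \<rightarrow>\<^sub>E V. h g) = (\<Sum>(w, g)\<in>V \<times> (X \<rightarrow>\<^sub>E V). h (g(n := w)))"
    unfolding PiE_insert_eq
    by (subst sum.reindex[OF inj_combinator[OF assms(1)]]) (simp add: case_prod_unfold)
  also have "\<dots> = (\<Sum>w\<in>V. \<Sum>g\<in>X \<rightarrow>\<^sub>E V. h (g(n := w)))"
    by (simp add: sum.cartesian_product)
  finally show ?thesis by (subst sum.swap) simp
qed

lemma has_deriv_prod:
  fixes F :: "'v \<Rightarrow> real \<Rightarrow> real" and d :: "'v \<Rightarrow> nat"
  assumes "finite V" and smooth: "\<And>v. v \<in> V \<Longrightarrow> smooth (F v)"
  shows "((\<lambda>x. \<Prod>v\<in>V. (deriv ^^ d v) (F v) x) has_real_derivative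
    (\<Sum>w\<in>V. \<Prod>v\<in>V. (deriv ^^ (d v + (if v = w then 1 else 0))) (F v) x)) (at x)"
proof -
  have "((\<lambda>x. \<Prod>v\<in>V. (deriv ^^ d v) (F v) x) has_real_derivative
      (\<Sum>w\<in>V. (deriv ^^ Suc (d w)) (F w) x * (\<Prod>v\<in>V - {w}. (deriv ^^ d v) (F v) x))) (at x)"
    by (intro has_field_derivative_prod smooth_has_deriv smooth)
  moreover have "(deriv ^^ Suc (d w)) (F w) x * (\<Prod>v\<in>V - {w}. (deriv ^^ d v) (F v) x) =
      (\<Prod>v\<in>V. (deriv ^^ (d v + (if v = w then 1 else 0))) (F v) x)" if "w \<in> V" for w
    using assms(1) that by (subst prod.remove[of V w]) auto
  ultimately show ?thesis by simp
qed

text \<open>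
  The Leibniz rule in the form suited to grafting: label the differentiations by the elements of
  \<open>X\<close>; each term records by \<open>g\<close> which factor is hit by which differentiation.
\<close>

lemma higher_deriv_prod:
  fixes F :: "'v \<Rightarrow> real \<Rightarrow> real" and k :: "'v \<Rightarrow> nat"
  assumes "finite X" "finite V" and smooth: "\<And>v. v \<in> V \<Longrightarrow> smooth (F v)"
  shows "(deriv ^^ card X) (\<lambda>x. \<Prod>v\<in>V. (deriv ^^ k v) (F v) x) =
    (\<lambda>x. \<Sum>g\<in>X \<rightarrow>\<^sub>E V. \<Prod>v\<in>V. (deriv ^^ (k v + card {i \<in> X. g i = v})) (F v) x)"
  using assms(1)
proof induction
  case empty
  then show ?case by simp
next
  case (insert n X)
  let ?d = "\<lambda>X g v. k v + card {i \<in> X. g i = v}"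
  let ?P = "\<lambda>d x. \<Prod>v\<in>V. (deriv ^^ d v) (F v) x"
  have bump: "?d (insert n X) (g(n := w)) v = ?d X g v + (if v = w then 1 else 0)" for g v w
  proof -
    have "{i \<in> insert n X. (g(n := w)) i = v} =
        (if v = w then insert n {i \<in> X. g i = v} else {i \<in> X. g i = v})"
      using insert.hyps by auto
    then show ?thesis using insert.hyps by simp
  qed
  have "(deriv ^^ card (insert n X)) (?P k) = deriv ((deriv ^^ card X) (?P k))"
    using insert.hyps by simp
  also have "\<dots> = deriv (\<lambda>x. \<Sum>g\<in>X \<rightarrow>\<^sub>E V. ?P (?d X g) x)"
    by (simp only: insert.IH)
  also have "\<dots> = (\<lambda>x. \<Sum>g\<in>X \<rightarrow>\<^sub>E V. \<Sum>w\<in>V. ?P (\<lambda>v. ?d X g v + (if v = w then 1 else 0)) x)"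
    by (intro ext DERIV_imp_deriv DERIV_sum has_deriv_prod assms(2) smooth)
  also have "\<dots> = (\<lambda>x. \<Sum>g\<in>X \<rightarrow>\<^sub>E V. \<Sum>w\<in>V. ?P (?d (insert n X) (g(n := w))) x)"
    by (simp only: bump)
  also have "\<dots> = (\<lambda>x. \<Sum>g\<in>insert n X \<rightarrow>\<^sub>E V. ?P (?d (insert n X) g) x)"
    by (intro ext, rule sum_PiE_insert[OF insert.hyps(2,1) assms(2), symmetric])
  finally show ?case .
qed

lemma smooth_prod:
  fixes F :: "'v \<Rightarrow> real \<Rightarrow> real" and k :: "'v \<Rightarrow> nat"
  assumes "finite V" "\<And>v. v \<in> V \<Longrightarrow> smooth (F v)"
  shows "smooth (\<lambda>x. \<Prod>v\<in>V. (deriv ^^ k v) (F v) x)"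
  unfolding smooth_def
proof (intro allI)
  fix n :: nat and x :: real
  have "(\<lambda>x. \<Sum>g\<in>{..<n} \<rightarrow>\<^sub>E V. \<Prod>v\<in>V. (deriv ^^ (k v + card {i \<in> {..<n}. g i = v})) (F v) x)
      differentiable at x"
    unfolding real_differentiable_def
    by (rule exI, rule DERIV_sum, rule has_deriv_prod[OF assms])
  then show "(deriv ^^ n) (\<lambda>x. \<Prod>v\<in>V. (deriv ^^ k v) (F v) x) differentiable at x"
    using higher_deriv_prod[of "{..<n}" V F k] assms by simp
qed

lemma higher_deriv_sum:
  assumes "\<And>i. i \<in> A \<Longrightarrow> smooth (g i)"
  shows "(deriv ^^ n) (\<lambda>x. \<Sum>i\<in>A. b i * g i x) = (\<lambda>x. \<Sum>i\<in>A. b i * (deriv ^^ n) (g i) x)"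
proof (induction n)
  case (Suc n)
  have "deriv (\<lambda>x. \<Sum>i\<in>A. b i * (deriv ^^ n) (g i) x) =
      (\<lambda>x. \<Sum>i\<in>A. b i * (deriv ^^ Suc n) (g i) x)"
    by (intro ext DERIV_imp_deriv DERIV_sum DERIV_cmult smooth_has_deriv assms)
  then show ?case using Suc.IH by simp
qed simp

lemma generator_sum:
  assumes "\<And>i. i \<in> A \<Longrightarrow> smooth (g i)"
  shows "generator \<alpha> \<beta> (\<lambda>x. \<Sum>i\<in>A. b i * g i x) = (\<lambda>x. \<Sum>i\<in>A. b i * generator \<alpha> \<beta> (g i) x)"
  using higher_deriv_sum[of A g 1 b] higher_deriv_sum[of A g 2 b] assms
  by (simp add: generator_def fun_eq_iff sum_distrib_left sum.distrib algebra_simps)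

section \<open>The generator acts by grafting\<close>

lemma UNIV_colour: "UNIV = {Alpha, Beta}"
  by (auto intro: colour.exhaust)

instance colour :: finite
  by standard (simp add: UNIV_colour)

lemma sum_colour: "(\<Sum>c\<in>UNIV. h c) = h Alpha + h Beta"
  by (simp add: UNIV_colour)

fun coefficient :: "(real \<Rightarrow> real) \<Rightarrow> (real \<Rightarrow> real) \<Rightarrow> colour \<Rightarrow> real \<Rightarrow> real" where
  "coefficient \<alpha> \<beta> Alpha = \<alpha>"
| "coefficient \<alpha> \<beta> Beta = \<beta>"

lemma generator_by_colour:
  "generator \<alpha> \<beta> g x =
    (\<Sum>c\<in>UNIV. coefficient \<alpha> \<beta> c x ^ arity c / fact (arity c) * (deriv ^^ arity c) g x)"
  by (simp add: generator_def sum_colour)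

lemma exotic_tree_cases:
  obtains t where "exotic_wf t" "\<tau> = abs_exotic_tree t"
  using rep_exotic_tree_refl abs_rep_exotic_tree by (metis exotic_equiv_def)

lemma wf_rep: "exotic_wf (rep_exotic_tree \<tau>)"
  using rep_exotic_tree_refl exotic_equiv_def by blast

lemma exotic_equiv_refl: "exotic_wf t \<Longrightarrow> exotic_equiv t t"
  using exotic_iso_refl exotic_equiv_def by blast

lemma abs_exotic_tree_eq_iff:
  "exotic_wf s \<Longrightarrow> exotic_wf t \<Longrightarrow> abs_exotic_tree s = abs_exotic_tree t \<longleftrightarrow> exotic_equiv s t"
  using Quotient3_rel[OF Quotient3_exotic_tree, of s t] exotic_equiv_refl by blast

lemma symmetry_factor_abs:
  "exotic_wf t \<Longrightarrow> symmetry_factor (abs_exotic_tree t) = card (tree_autos t)"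
  unfolding tree_autos_def by (rule symmetry_factor.abs_eq[OF exotic_equiv_refl])

lemma symmetry_factor_pos: "symmetry_factor \<tau> > 0"
  using card_tree_autos_pos symmetry_factor_abs by (metis exotic_tree_cases)

lemma tree_order_abs:
  "exotic_wf t \<Longrightarrow> tree_order (abs_exotic_tree t) =
    card (coloured_verts Alpha t) + card (coloured_verts Beta t) div 2 + 1"
  by (rule tree_order.abs_eq[OF exotic_equiv_refl])

definition vertex_function ::
    "(real \<Rightarrow> real) \<Rightarrow> (real \<Rightarrow> real) \<Rightarrow> (real \<Rightarrow> real) \<Rightarrow> pre_tree \<Rightarrow> nat \<Rightarrow> real \<Rightarrow> real" where
  "vertex_function \<alpha> \<beta> f t v = (if v = troot t then f else coefficient \<alpha> \<beta> (vcolour t v))"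

lemma elementary_differential_abs:
  assumes "exotic_wf t"
  shows "elementary_differential \<alpha> \<beta> f x (abs_exotic_tree t) =
    (\<Prod>v\<in>verts t. (deriv ^^ card (children t v)) (vertex_function \<alpha> \<beta> f t v) x)"
proof -
  have "finite (verts t)" "troot t \<in> verts t" using assms by (auto simp: exotic_wf_def)
  moreover have "(case vcolour t v of Alpha \<Rightarrow> \<alpha> | Beta \<Rightarrow> \<beta>) = coefficient \<alpha> \<beta> (vcolour t v)" for v
    by (cases "vcolour t v") simp_all
  ultimately show ?thesis
    unfolding elementary_differential.abs_eq[OF exotic_equiv_refl[OF assms]]
    by (simp add: prod.remove inner_verts_def vertex_function_def)
qed

lemma smooth_vertex_function:
  assumes "smooth \<alpha>" "smooth \<beta>" "smooth f"
  shows "smooth (vertex_function \<alpha> \<beta> f t v)"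
  using assms by (cases "vcolour t v") (simp_all add: vertex_function_def)

lemma smooth_elementary_differential:
  assumes "smooth \<alpha>" "smooth \<beta>" "smooth f"
  shows "smooth (\<lambda>x. elementary_differential \<alpha> \<beta> f x \<tau>)"
proof -
  obtain t where t: "exotic_wf t" "\<tau> = abs_exotic_tree t" by (rule exotic_tree_cases)
  then show ?thesis
    using smooth_vertex_function[OF assms]
    by (simp add: elementary_differential_abs smooth_prod exotic_wf_def)
qed

text \<open>A common name for \<open>m_alpha\<close> and \<open>m_beta\<close>, so that sums can run over the colours.\<close>

definition removals :: "colour \<Rightarrow> exotic_tree \<Rightarrow> exotic_tree \<Rightarrow> nat" where
  "removals c = (case c of Alpha \<Rightarrow> m_alpha | Beta \<Rightarrow> m_beta)"

lemma removals_abs: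
  assumes "exotic_wf s" "exotic_wf t"
  shows "removals c (abs_exotic_tree s) (abs_exotic_tree t) =
    card {B \<in> removable_blocks c t. exotic_equiv (remove_verts t B) s}"
proof (cases c)
  case Alpha
  have "{B \<in> removable_blocks Alpha t. exotic_equiv (remove_verts t B) s} =
      (\<lambda>v. {v}) ` {v \<in> alpha_leaves t. exotic_equiv (remove_verts t {v}) s}"
    by (auto simp: removable_blocks_Alpha)
  then show ?thesis
    using Alpha m_alpha.abs_eq[OF assms[THEN exotic_equiv_refl]]
    by (simp add: removals_def card_image)
next
  case Beta
  then show ?thesis
    using m_beta.abs_eq[OF assms[THEN exotic_equiv_refl]] assms(2)
    by (simp add: removals_def removable_blocks_Beta)
qed

lemma finite_removals: "finite {\<tau>'. removals c \<tau>' \<tau> \<noteq> 0}"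
  unfolding removals_def using finite_m_alpha finite_m_beta by (cases c) simp_all

lemma inverse_tree_factorial_rec:
  assumes "tree_order \<tau> > 1"
  shows "real (tree_order \<tau>) * inverse_tree_factorial \<tau> =
    (\<Sum>c\<in>UNIV. \<Sum>\<tau>' | removals c \<tau>' \<tau> \<noteq> 0. real (removals c \<tau>' \<tau>) * inverse_tree_factorial \<tau>')"
  using assms by (subst inverse_tree_factorial.simps) (simp add: sum_colour removals_def)

text \<open>
  Grafting is performed on the chosen representative of a class. Any other fresh vertices and any
  other representative would give the same numbers of attachments.
\<close>

definition new_verts :: "colour \<Rightarrow> exotic_tree \<Rightarrow> nat set" where
  "new_verts c \<tau> = (let m = Suc (Max (verts (rep_exotic_tree \<tau>))) in {m..<m + arity c})"

definition attachments :: "colour \<Rightarrow> exotic_tree \<Rightarrow> (nat \<Rightarrow> nat) set" where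
  "attachments c \<tau> = new_verts c \<tau> \<rightarrow>\<^sub>E verts (rep_exotic_tree \<tau>)"

definition attach :: "colour \<Rightarrow> exotic_tree \<Rightarrow> (nat \<Rightarrow> nat) \<Rightarrow> exotic_tree" where
  "attach c \<tau> g = abs_exotic_tree (graft c (new_verts c \<tau>) g (rep_exotic_tree \<tau>))"

lemma grafting_new_verts: "grafting (rep_exotic_tree \<tau>) c (new_verts c \<tau>)"
proof
  show "exotic_wf (rep_exotic_tree \<tau>)" by (rule wf_rep)
  then have fin: "finite (verts (rep_exotic_tree \<tau>))" by (simp add: exotic_wf_def)
  have "v < Suc (Max (verts (rep_exotic_tree \<tau>)))" if "v \<in> verts (rep_exotic_tree \<tau>)" for v
    using Max_ge[OF fin that] by simp
  then show "new_verts c \<tau> \<inter> verts (rep_exotic_tree \<tau>) = {}"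
    by (fastforce simp: new_verts_def Let_def)
  show "card (new_verts c \<tau>) = arity c" by (simp add: new_verts_def Let_def)
qed

lemma wf_graft_attachment:
  "g \<in> attachments c \<tau> \<Longrightarrow> exotic_wf (graft c (new_verts c \<tau>) g (rep_exotic_tree \<tau>))"
  by (rule grafting.wf_graft[OF grafting_new_verts]) (auto simp: attachments_def)

lemma finite_attachments: "finite (attachments c \<tau>)"
  using grafting.finite_X[OF grafting_new_verts] grafting.finite_verts[OF grafting_new_verts]
  unfolding attachments_def by (intro finite_PiE) auto

lemma tree_order_attach:
  assumes g: "g \<in> attachments c \<tau>"
  shows "tree_order (attach c \<tau> g) = Suc (tree_order \<tau>)"
proof -
  interpret grafting "rep_exotic_tree \<tau>" c "new_verts c \<tau>" by (rule grafting_new_verts)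
  let ?t = "rep_exotic_tree \<tau>"
  have "card (coloured_verts c ?t \<union> new_verts c \<tau>) = card (coloured_verts c ?t) + arity c"
    using finite_coloured[OF wf] finite_X card_X inner_fresh
    by (subst card_Un_disjoint) (auto simp: coloured_verts_def)
  moreover have "tree_order \<tau> =
      card (coloured_verts Alpha ?t) + card (coloured_verts Beta ?t) div 2 + 1"
    using tree_order_abs[OF wf] by (simp add: abs_rep_exotic_tree)
  ultimately show ?thesis
    unfolding attach_def tree_order_abs[OF wf_graft_attachment[OF g]]
    using coloured_graft[of Alpha g] coloured_graft[of Beta g] by (cases c) simp_all
qed

text \<open>
  The double count expressed on isomorphism classes. It converts sums over attachments, as produced
  by the generator, into sums over removals, as used by the tree factorial.
\<close>

lemma attach_removal_balance:
  "card {g \<in> attachments c \<tau>'. attach c \<tau>' g = \<tau>} * symmetry_factor \<tau> =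
    fact (arity c) * removals c \<tau>' \<tau> * symmetry_factor \<tau>'"
proof -
  obtain t where t: "exotic_wf t" "\<tau> = abs_exotic_tree t" by (rule exotic_tree_cases)
  let ?t' = "rep_exotic_tree \<tau>'"
  have "removals c \<tau>' \<tau> = card {B \<in> removable_blocks c t. exotic_equiv (remove_verts t B) ?t'}"
    using removals_abs[OF wf_rep t(1), of c \<tau>'] t(2) by (simp add: abs_rep_exotic_tree)
  moreover have "symmetry_factor \<tau>' = card (tree_autos ?t')"
    using symmetry_factor_abs[OF wf_rep, of \<tau>'] by (simp add: abs_rep_exotic_tree)
  moreover have "{g \<in> attachments c \<tau>'. attach c \<tau>' g = \<tau>} =
      {g \<in> attachments c \<tau>'. exotic_equiv (graft c (new_verts c \<tau>') g ?t') t}"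
    using abs_exotic_tree_eq_iff[OF wf_graft_attachment t(1)] t(2) by (auto simp: attach_def)
  ultimately show ?thesis
    using grafting.graft_removal_balance[OF grafting_new_verts t(1), of c \<tau>']
      symmetry_factor_abs[OF t(1)] t(2)
    by (simp add: attachments_def)
qed

lemma removals_imp_attach:
  assumes "removals c \<tau>' \<tau> \<noteq> 0"
  shows "\<tau> \<in> attach c \<tau>' ` attachments c \<tau>'"
proof -
  have "card {g \<in> attachments c \<tau>'. attach c \<tau>' g = \<tau>} \<noteq> 0"
    using attach_removal_balance[of c \<tau>' \<tau>] assms symmetry_factor_pos[of \<tau>']
    by (metis fact_nonzero mult_is_0 less_irrefl)
  then have "{g \<in> attachments c \<tau>'. attach c \<tau>' g = \<tau>} \<noteq> {}" by (metis card.empty)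
  then show ?thesis by blast
qed

text \<open>
  The \<open>r\<close> derivatives raise the vertex degrees as the \<open>r\<close> new edges do, and the \<open>r\<close>-th power of
  the coefficient function supplies the factors of the new leaves.
\<close>

lemma generator_elementary_differential:
  assumes smooth: "smooth \<alpha>" "smooth \<beta>" "smooth f"
  shows "generator \<alpha> \<beta> (\<lambda>y. elementary_differential \<alpha> \<beta> f y \<tau>) x =
    (\<Sum>c\<in>UNIV. (\<Sum>g\<in>attachments c \<tau>. elementary_differential \<alpha> \<beta> f x (attach c \<tau> g)) /
      fact (arity c))"
proof -
  let ?t = "rep_exotic_tree \<tau>"
  let ?F = "vertex_function \<alpha> \<beta> f"
  have "coefficient \<alpha> \<beta> c x ^ arity c * (deriv ^^ arity c) (\<lambda>y. elementary_differential \<alpha> \<beta> f y \<tau>) x =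
      (\<Sum>g\<in>attachments c \<tau>. elementary_differential \<alpha> \<beta> f x (attach c \<tau> g))" for c
  proof -
    let ?X = "new_verts c \<tau>"
    interpret grafting ?t c ?X by (rule grafting_new_verts)
    have "(\<lambda>y. elementary_differential \<alpha> \<beta> f y \<tau>) =
        (\<lambda>y. \<Prod>v\<in>verts ?t. (deriv ^^ card (children ?t v)) (?F ?t v) y)"
      using elementary_differential_abs[OF wf] by (simp add: abs_rep_exotic_tree)
    then have "(deriv ^^ arity c) (\<lambda>y. elementary_differential \<alpha> \<beta> f y \<tau>) x =
        (\<Sum>g\<in>attachments c \<tau>. \<Prod>v\<in>verts ?t.
          (deriv ^^ (card (children ?t v) + card {i \<in> ?X. g i = v})) (?F ?t v) x)"
      using higher_deriv_prod[OF finite_X finite_verts smooth_vertex_function[OF smooth]]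
      by (simp add: card_X attachments_def)
    moreover have "elementary_differential \<alpha> \<beta> f x (attach c \<tau> g) =
        coefficient \<alpha> \<beta> c x ^ arity c * (\<Prod>v\<in>verts ?t.
          (deriv ^^ (card (children ?t v) + card {i \<in> ?X. g i = v})) (?F ?t v) x)"
      if g: "g \<in> attachments c \<tau>" for g
    proof -
      let ?s = "graft c ?X g ?t"
      let ?D = "\<lambda>v. (deriv ^^ card (children ?s v)) (?F ?s v) x"
      have g': "g \<in> ?X \<rightarrow> verts ?t" using g by (auto simp: attachments_def)
      have "elementary_differential \<alpha> \<beta> f x (attach c \<tau> g) = (\<Prod>v\<in>verts ?t \<union> ?X. ?D v)"
        unfolding attach_def elementary_differential_abs[OF wf_graft[OF g']] by simp
      also have "\<dots> = (\<Prod>v\<in>verts ?t. ?D v) * (\<Prod>v\<in>?X. ?D v)"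
        using fresh finite_verts finite_X by (intro prod.union_disjoint) auto
      also have "(\<Prod>v\<in>?X. ?D v) = (\<Prod>v\<in>?X. coefficient \<alpha> \<beta> c x)"
        using children_graft_new[OF g'] root(2) by (intro prod.cong) (auto simp: vertex_function_def)
      also have "(\<Prod>v\<in>verts ?t. ?D v) = (\<Prod>v\<in>verts ?t.
          (deriv ^^ (card (children ?t v) + card {i \<in> ?X. g i = v})) (?F ?t v) x)"
      proof (rule prod.cong[OF refl])
        fix v assume v: "v \<in> verts ?t"
        have "v \<notin> ?X" using v fresh by blast
        then have "?F ?s v = ?F ?t v" by (simp add: vertex_function_def)
        moreover have "card (children ?s v) = card (children ?t v) + card {i \<in> ?X. g i = v}"
          unfolding children_graft[OF v] using inner_fresh finite_X finite_verts
          by (subst card_Un_disjoint) (auto simp: children_def inner_verts_def)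
        ultimately show "?D v =
            (deriv ^^ (card (children ?t v) + card {i \<in> ?X. g i = v})) (?F ?t v) x" by simp
      qed
      finally show ?thesis by (simp add: card_X mult.commute)
    qed
    ultimately show ?thesis by (simp add: sum_distrib_left)
  qed
  then show ?thesis by (simp add: generator_by_colour)
qed

section \<open>Iterating the generator\<close>

definition bullet :: exotic_tree where
  "bullet = abs_exotic_tree
     \<lparr>verts = {0}, troot = 0, parent = \<lambda>_. 0, vcolour = \<lambda>_. Alpha, pairing = {}\<rparr>"

lemma wf_bullet:
  "exotic_wf \<lparr>verts = {0}, troot = 0, parent = \<lambda>_. 0, vcolour = \<lambda>_. Alpha, pairing = {}\<rparr>"
  by (auto simp: exotic_wf_def inner_verts_def coloured_verts_def partition_on_def
      intro: exI[of _ 0])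

lemma tree_order_bullet: "tree_order bullet = 1"
  unfolding bullet_def tree_order_abs[OF wf_bullet]
  by (simp add: coloured_verts_def inner_verts_def)

lemma symmetry_factor_bullet: "symmetry_factor bullet = 1"
proof -
  have "{\<phi>. \<phi> = id \<and> exotic_iso \<phi> t t} = {id}" for t using exotic_iso_refl by auto
  then show ?thesis
    unfolding bullet_def symmetry_factor_abs[OF wf_bullet] tree_autos_def by simp
qed

lemma elementary_differential_bullet: "elementary_differential \<alpha> \<beta> f x bullet = f x"
  unfolding bullet_def elementary_differential_abs[OF wf_bullet]
  by (simp add: children_def inner_verts_def vertex_function_def)

lemma inverse_tree_factorial_bullet: "inverse_tree_factorial bullet = 1"
  by (subst inverse_tree_factorial.simps) (simp add: tree_order_bullet)

lemma tree_order_pos: "tree_order \<tau> \<ge> 1"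
  by (metis exotic_tree_cases tree_order_abs le_add2)

lemma tree_order_1_imp_bullet:
  assumes "tree_order \<tau> = 1"
  shows "\<tau> = bullet"
proof -
  obtain t where t: "exotic_wf t" "\<tau> = abs_exotic_tree t" by (rule exotic_tree_cases)
  have fin: "finite (coloured_verts c t)" for c by (rule finite_coloured[OF t(1)])
  have part: "partition_on (coloured_verts Beta t) (pairing t)" "\<forall>p\<in>pairing t. card p = 2"
    using t(1) by (auto simp: exotic_wf_def)
  \<comment> \<open>The order only bounds the number of \<open>\<beta>\<close>-vertices by one; the pairing makes it even.\<close>
  have "2 * card (pairing t) = card (coloured_verts Beta t)"
    using card_partition[of "pairing t" 2] part fin[of Beta] finite_elements[OF fin part(1)]
    by (auto simp: partition_on_def disjoint_def)
  moreover have "card (coloured_verts Alpha t) = 0" "card (coloured_verts Beta t) div 2 = 0"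
    using assms tree_order_abs[OF t(1)] t(2) by auto
  ultimately have "card (coloured_verts c t) = 0" for c by (cases c; presburger)
  then have "coloured_verts c t = {}" for c using fin by simp
  then have "inner_verts t = {}" by (auto simp: coloured_verts_def)
  then have V: "verts t = {troot t}" using t(1) by (auto simp: inner_verts_def exotic_wf_def)
  have "pairing t = {}"
    using pairing_subset(1)[OF t(1)] \<open>\<And>c. coloured_verts c t = {}\<close> part(2) by fastforce
  then have "exotic_iso (\<lambda>_. 0) t
      \<lparr>verts = {0}, troot = 0, parent = \<lambda>_. 0, vcolour = \<lambda>_. Alpha, pairing = {}\<rparr>"
    using V \<open>inner_verts t = {}\<close> by (auto simp: exotic_iso_def)
  then show ?thesis
    unfolding t(2) bullet_def using abs_exotic_tree_eq_iff[OF t(1) wf_bullet] t(1) wf_bullet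
    by (auto simp: exotic_equiv_def)
qed

text \<open>
  The trees that occur in the \<open>k\<close>-th iterate of the generator. Not every tree of order \<open>k + 1\<close> is
  among them: a paired \<open>\<beta>\<close>-vertex below its own partner, for instance, can never be removed.
\<close>

primrec grown :: "nat \<Rightarrow> exotic_tree set" where
  "grown 0 = {bullet}"
| "grown (Suc k) = (\<Union>\<tau>\<in>grown k. \<Union>c. attach c \<tau> ` attachments c \<tau>)"

lemma finite_grown: "finite (grown k)"
  by (induction k) (auto simp: finite_attachments)

lemma tree_order_grown: "\<tau> \<in> grown k \<Longrightarrow> tree_order \<tau> = Suc k"
  by (induction k arbitrary: \<tau>) (auto simp: tree_order_bullet tree_order_attach)

lemma tree_order_removals: "removals c \<tau>' \<tau> \<noteq> 0 \<Longrightarrow> tree_order \<tau> = Suc (tree_order \<tau>')"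
  using removals_imp_attach tree_order_attach by blast

text \<open>
  If \<open>1/\<tau>!\<close> is nonzero, then so is a term of its recursion, and by the double count a nonzero
  multiplicity of removal means that \<open>\<tau>\<close> is obtained by an attachment.
\<close>

lemma in_grown:
  "inverse_tree_factorial \<tau> \<noteq> 0 \<Longrightarrow> tree_order \<tau> = Suc k \<Longrightarrow> \<tau> \<in> grown k"
proof (induction k arbitrary: \<tau>)
  case 0
  then show ?case using tree_order_1_imp_bullet by simp
next
  case (Suc k)
  have "real (tree_order \<tau>) * inverse_tree_factorial \<tau> \<noteq> 0" using Suc.prems by simp
  then obtain c where "(\<Sum>\<tau>' | removals c \<tau>' \<tau> \<noteq> 0.
      real (removals c \<tau>' \<tau>) * inverse_tree_factorial \<tau>') \<noteq> 0"
    using Suc.prems(2) inverse_tree_factorial_rec[of \<tau>]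
    by (metis (no_types, lifting) sum.neutral One_nat_def Suc_less_eq zero_less_Suc)
  then obtain \<tau>' where "removals c \<tau>' \<tau> \<noteq> 0" "inverse_tree_factorial \<tau>' \<noteq> 0"
    by (metis (mono_tags, lifting) mem_Collect_eq mult_zero_right sum.neutral)
  moreover from this have "\<tau>' \<in> grown k"
    using Suc tree_order_removals by (metis Suc_inject)
  ultimately show ?case using removals_imp_attach by fastforce
qed

text \<open>
  Smaller trees that the generator does not produce satisfy \<open>1/\<tau>'! = 0\<close>, so the recursion may be
  restricted to those that it produces.
\<close>

lemma inverse_tree_factorial_grown:
  assumes "\<tau> \<in> grown (Suc k)"
  shows "(\<Sum>c\<in>UNIV. \<Sum>\<tau>'\<in>grown k. real (removals c \<tau>' \<tau>) * inverse_tree_factorial \<tau>') =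
    real (tree_order \<tau>) * inverse_tree_factorial \<tau>"
proof -
  have "(\<Sum>\<tau>'\<in>grown k. real (removals c \<tau>' \<tau>) * inverse_tree_factorial \<tau>') =
      (\<Sum>\<tau>' | removals c \<tau>' \<tau> \<noteq> 0. real (removals c \<tau>' \<tau>) * inverse_tree_factorial \<tau>')" for c
  proof (rule sum.mono_neutral_cong)
    show "real (removals c \<tau>' \<tau>) * inverse_tree_factorial \<tau>' = 0"
      if "\<tau>' \<in> {\<tau>'. removals c \<tau>' \<tau> \<noteq> 0} - grown k" for \<tau>'
    proof -
      have "tree_order \<tau>' = Suc k"
        using that tree_order_removals[of c \<tau>' \<tau>] tree_order_grown[OF assms] by auto
      then show ?thesis using in_grown that by auto
    qed
  qed (use finite_grown finite_removals in auto)
  then show ?thesis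
    using inverse_tree_factorial_rec[of \<tau>] tree_order_grown[OF assms] by simp
qed

text \<open>
  In the induction step the symmetry factor of the smaller tree cancels, by the balance of
  attachments and removals. The remaining sum over the smaller trees is the right-hand side of
  the recursion for \<open>1/\<tau>!\<close>; since \<open>|\<tau>'| = k + 1\<close>, the factor \<open>|\<tau>'|\<close> turns \<open>k!\<close> into \<open>(k + 1)!\<close>.
\<close>

lemma generator_power:
  assumes smooth: "smooth \<alpha>" "smooth \<beta>" "smooth f"
  shows "(generator \<alpha> \<beta> ^^ k) f = (\<lambda>x. \<Sum>\<tau>\<in>grown k.
    fact k * (real (tree_order \<tau>) / real (symmetry_factor \<tau>) * inverse_tree_factorial \<tau>) *
    elementary_differential \<alpha> \<beta> f x \<tau>)"
proof (induction k)
  case 0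
  then show ?case
    by (simp add: tree_order_bullet symmetry_factor_bullet inverse_tree_factorial_bullet
        elementary_differential_bullet)
next
  case (Suc k)
  let ?w = inverse_tree_factorial and ?\<sigma> = "\<lambda>\<tau>. real (symmetry_factor \<tau>)"
  let ?U = "elementary_differential \<alpha> \<beta> f"
  have IH: "(generator \<alpha> \<beta> ^^ k) f =
      (\<lambda>x. \<Sum>\<tau>\<in>grown k. fact (Suc k) * (?w \<tau> / ?\<sigma> \<tau>) * ?U x \<tau>)"
    unfolding Suc.IH by (intro ext sum.cong refl) (simp add: tree_order_grown)
  have step: "generator \<alpha> \<beta> (\<lambda>y. ?U y \<tau>') x =
      (\<Sum>c\<in>UNIV. \<Sum>\<tau>\<in>grown (Suc k). real (removals c \<tau>' \<tau>) * ?\<sigma> \<tau>' / ?\<sigma> \<tau> * ?U x \<tau>)"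
    if \<tau>': "\<tau>' \<in> grown k" for \<tau>' x
  proof -
    have "(\<Sum>g\<in>attachments c \<tau>'. ?U x (attach c \<tau>' g)) / fact (arity c) =
        (\<Sum>\<tau>\<in>grown (Suc k). real (removals c \<tau>' \<tau>) * ?\<sigma> \<tau>' / ?\<sigma> \<tau> * ?U x \<tau>)" for c
    proof -
      have "(\<Sum>g\<in>attachments c \<tau>'. ?U x (attach c \<tau>' g)) =
          (\<Sum>\<tau>\<in>grown (Suc k). \<Sum>g | g \<in> attachments c \<tau>' \<and> attach c \<tau>' g = \<tau>. ?U x (attach c \<tau>' g))"
        by (rule sum.group[symmetric]) (use \<tau>' finite_attachments finite_grown[of "Suc k"] in auto)
      also have "\<dots> = (\<Sum>\<tau>\<in>grown (Suc k).
          real (card {g \<in> attachments c \<tau>'. attach c \<tau>' g = \<tau>}) * ?U x \<tau>)"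
        by (intro sum.cong refl) simp
      also have "\<dots> = (\<Sum>\<tau>\<in>grown (Suc k).
          fact (arity c) * (real (removals c \<tau>' \<tau>) * ?\<sigma> \<tau>' / ?\<sigma> \<tau> * ?U x \<tau>))"
      proof (intro sum.cong refl)
        fix \<tau>
        have "real (card {g \<in> attachments c \<tau>'. attach c \<tau>' g = \<tau>}) * ?\<sigma> \<tau> =
            fact (arity c) * real (removals c \<tau>' \<tau>) * ?\<sigma> \<tau>'"
          using attach_removal_balance[of c \<tau>' \<tau>]
          by (metis of_nat_fact of_nat_mult)
        then have "real (card {g \<in> attachments c \<tau>'. attach c \<tau>' g = \<tau>}) =
            fact (arity c) * real (removals c \<tau>' \<tau>) * ?\<sigma> \<tau>' / ?\<sigma> \<tau>"
          using symmetry_factor_pos[of \<tau>] by (simp add: field_simps)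
        then show "real (card {g \<in> attachments c \<tau>'. attach c \<tau>' g = \<tau>}) * ?U x \<tau> =
            fact (arity c) * (real (removals c \<tau>' \<tau>) * ?\<sigma> \<tau>' / ?\<sigma> \<tau> * ?U x \<tau>)"
          by simp
      qed
      finally show ?thesis by (simp only: sum_distrib_left[symmetric]) simp
    qed
    then show ?thesis using generator_elementary_differential[OF smooth] by simp
  qed
  have "(generator \<alpha> \<beta> ^^ Suc k) f x = (\<Sum>\<tau>\<in>grown (Suc k). fact (Suc k) *
      (real (tree_order \<tau>) / ?\<sigma> \<tau> * ?w \<tau>) * ?U x \<tau>)" for x
  proof -
    have "(generator \<alpha> \<beta> ^^ Suc k) f x =
        generator \<alpha> \<beta> (\<lambda>x. \<Sum>\<tau>'\<in>grown k. fact (Suc k) * (?w \<tau>' / ?\<sigma> \<tau>') * ?U x \<tau>') x"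
      by (simp only: funpow.simps o_apply IH)
    also have "\<dots> = (\<Sum>\<tau>'\<in>grown k. fact (Suc k) * (?w \<tau>' / ?\<sigma> \<tau>') *
        generator \<alpha> \<beta> (\<lambda>y. ?U y \<tau>') x)"
      by (simp only: generator_sum[OF smooth_elementary_differential[OF smooth]])
    also have "\<dots> = (\<Sum>\<tau>'\<in>grown k. \<Sum>c\<in>UNIV. \<Sum>\<tau>\<in>grown (Suc k).
        fact (Suc k) * (real (removals c \<tau>' \<tau>) * ?w \<tau>') / ?\<sigma> \<tau> * ?U x \<tau>)"
    proof (intro sum.cong refl)
      fix \<tau>' assume "\<tau>' \<in> grown k"
      then show "fact (Suc k) * (?w \<tau>' / ?\<sigma> \<tau>') * generator \<alpha> \<beta> (\<lambda>y. ?U y \<tau>') x =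
          (\<Sum>c\<in>UNIV. \<Sum>\<tau>\<in>grown (Suc k).
            fact (Suc k) * (real (removals c \<tau>' \<tau>) * ?w \<tau>') / ?\<sigma> \<tau> * ?U x \<tau>)"
        using symmetry_factor_pos[of \<tau>']
        by (simp only: step sum_distrib_left, intro sum.cong refl) (simp add: divide_simps del: fact_Suc)
    qed
    also have "\<dots> = (\<Sum>\<tau>\<in>grown (Suc k). \<Sum>c\<in>UNIV. \<Sum>\<tau>'\<in>grown k.
        fact (Suc k) * (real (removals c \<tau>' \<tau>) * ?w \<tau>') / ?\<sigma> \<tau> * ?U x \<tau>)"
      by (subst sum.swap, subst (2) sum.swap, rule sum.swap)
    also have "\<dots> = (\<Sum>\<tau>\<in>grown (Suc k). fact (Suc k) *
        (\<Sum>c\<in>UNIV. \<Sum>\<tau>'\<in>grown k. real (removals c \<tau>' \<tau>) * ?w \<tau>') / ?\<sigma> \<tau> * ?U x \<tau>)"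
      by (simp only: sum_distrib_left sum_distrib_right sum_divide_distrib)
    also have "\<dots> = (\<Sum>\<tau>\<in>grown (Suc k). fact (Suc k) *
        (real (tree_order \<tau>) / ?\<sigma> \<tau> * ?w \<tau>) * ?U x \<tau>)"
      by (intro sum.cong refl) (simp only: inverse_tree_factorial_grown, simp)
    finally show ?thesis .
  qed
  then show ?case by (rule ext)
qed

theorem proposition1p1:
  fixes \<alpha> \<beta> f :: "real \<Rightarrow> real" and u\<^sub>0 T :: real
    and M :: "'a measure" and F :: "real \<Rightarrow> 'a measure" and W u :: "real \<Rightarrow> 'a \<Rightarrow> real"
  assumes "T > 0"
    and "smooth \<alpha>" "smooth \<beta>" "smooth f"
    and "real_analytic \<alpha>" "real_analytic \<beta>" "real_analytic f"
    and "wiener_process M F W"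
    and "unique_ito_solution M F W \<alpha> \<beta> u\<^sub>0 T u"
  shows "((\<lambda>\<tau>. fps_const (real (tree_order \<tau>) / real (symmetry_factor \<tau>)
              * inverse_tree_factorial \<tau> * elementary_differential \<alpha> \<beta> f u\<^sub>0 \<tau>)
            * fps_X ^ (tree_order \<tau> - 1))
          has_sum ito_taylor_series \<alpha> \<beta> f u\<^sub>0) (UNIV :: exotic_tree set)"
proof -
  define b where "b \<tau> = real (tree_order \<tau>) / real (symmetry_factor \<tau>) * inverse_tree_factorial \<tau> *
    elementary_differential \<alpha> \<beta> f u\<^sub>0 \<tau>" for \<tau>
  let ?S = "\<lambda>\<tau>. fps_const (b \<tau>) * fps_X ^ (tree_order \<tau> - 1)"
  have nth: "fps_nth (?S \<tau>) n = (if tree_order \<tau> = Suc n then b \<tau> else 0)" for \<tau> n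
    using tree_order_pos[of \<tau>] by auto
  have sub: "{\<tau> \<in> UNIV. fps_nth (?S \<tau>) n \<noteq> 0} \<subseteq> grown n" for n
    unfolding nth using in_grown by (auto simp: b_def split: if_splits)
  have "(?S has_sum ito_taylor_series \<alpha> \<beta> f u\<^sub>0) UNIV"
  proof (rule has_sum_fpsI)
    fix n
    show "finite {\<tau> \<in> UNIV. fps_nth (?S \<tau>) n \<noteq> 0}"
      using sub finite_grown by (rule finite_subset)
    have "fps_nth (ito_taylor_series \<alpha> \<beta> f u\<^sub>0) n = (\<Sum>\<tau>\<in>grown n. b \<tau>)"
      unfolding ito_taylor_series_def generator_power[OF assms(2-4)] b_def
      by (simp add: sum_divide_distrib mult.assoc)
    also have "\<dots> = (\<Sum>\<tau>\<in>grown n. fps_nth (?S \<tau>) n)"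
      by (intro sum.cong refl) (simp only: nth tree_order_grown, simp)
    also have "\<dots> = (\<Sum>\<tau> | \<tau> \<in> UNIV \<and> fps_nth (?S \<tau>) n \<noteq> 0. fps_nth (?S \<tau>) n)"
      using sub[of n] by (intro sum.mono_neutral_right finite_grown) auto
    finally show "fps_nth (ito_taylor_series \<alpha> \<beta> f u\<^sub>0) n =
        (\<Sum>\<tau> | \<tau> \<in> UNIV \<and> fps_nth (?S \<tau>) n \<noteq> 0. fps_nth (?S \<tau>) n)" .
  qed
  then show ?thesis by (simp only: b_def)
qed

end
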